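(* Let $L=K_1\cup\dots\cup K_\mu$ and $L'=K'_1\cup\dots\cup K'_{\mu'}$ be links. Consider the following conditions. 1. The fundamental quandles $Q(L)$ and $Q(L')$ are isomorphic. 2. The fundamental multivariate Alexander quandles $Q_A(L)$ and $Q_A(L')$ are isomorphic. 3. The components of $L$ and $L'$ can be indexed so that the link module sequences of $L$ and $L'$ are equivalent (in particular $\mu=\mu'$). 4. The total multivariate Alexander quandles $U(L)$ and $U(L')$ are isomorphic. Then the implications $1\implies 2\implies 3\implies 4$ hold.
   Context: A link $L=K_1\cup\dots\cup K_\mu$ is a union of finitely many pairwise disjoint, tame (piecewise smooth), oriented embedded circles in $\mathbb{S}^3$, with indexed components. A diagram $D$ of $L$ is obtained from a regular projection to the plane (finitely many singularities, all transverse double points called crossings) by removing short segments of the underpassing arc at each crossing. $C(D)$ is the set of crossings; $A(D)$ is the set of connected components of $D$, called arcs; $\kappa:A(D)\to\{1,\dots,\mu\}$ is such that the arc $a$ is part of the image of $K_{\kappa(a)}$. At a crossing $c$, let $a_1$ be the overpassing arc, $a_2$ the underpassing arc on the right side of $a_1$ and $a_3$ the underpassing arc on the left side of $a_1$ (with respect to the orientation of $a_1$); so $\kappa(a_2)=\kappa(a_3)$. A quandle is a set $Q$ with binary operations $\triangleright,\triangleright^{-1}$ such that for all $x,y,z$: (Q1) $x\triangleright x=x$; (Q2) $(x\triangleright y)\triangleright^{-1}y=x=(x\triangleright^{-1}y)\triangleright y$; (Q3) $(x\triangleright y)\triangleright z=(x\triangleright z)\triangleright(y\triangleright z)$. The fundamental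 quandle $Q(L)$ is the quandle generated by $A(D)$ subject to the relations $a_2\triangleright a_1=a_3$ and $a_3\triangleright^{-1}a_1=a_2$ at every crossing of $D$; up to isomorphism it does not depend on $D$. Let $\Lambda_\mu=\mathbb{Z}[t_1^{\pm1},\dots,t_\mu^{\pm1}]$. Let $\rho_D:\Lambda_\mu^{C(D)}\to\Lambda_\mu^{A(D)}$ be the $\Lambda_\mu$-linear map between free modules with $\rho_D(c)=(1-t_{\kappa(a_2)})a_1+t_{\kappa(a_1)}a_2-a_3$ at each crossing $c$. The Alexander module $M_A(L)$ is the cokernel of $\rho_D$, with quotient map $\gamma_D:\Lambda_\mu^{A(D)}\to M_A(L)$. Let $I_\mu$ be the ideal of $\Lambda_\mu$ generated by $t_1-1,\dots,t_\mu-1$, and let $\phi_L:M_A(L)\to I_\mu$ be the $\Lambda_\mu$-linear epimorphism with $\phi_L(\gamma_D(a))=t_{\kappa(a)}-1$ for all $a\in A(D)$. The link module sequence of $L$ is $0\to\ker\phi_L\to M_A(L)\xrightarrow{\phi_L}I_\mu\to0$. For links $L,L'$ with the same number $\mu$ of components, their link module sequences are equivalent if there is a $\Lambda_\mu$-linear isomorphism $f:M_A(L)\to M_A(L')$ with $\phi_L=\phi_{L'}f$. The total multivariate Alexander quandle is $U(L)=\{x\in M_A(L)\mid \phi_L(x)+1\text{ is a unit of }\Lambda_\mu\}$ with $x\triangleright y=(\phi_L(y)+1)x-\phi_L(x)y$ and $x\triangleright^{-1}y=(\phi_L(y)+1)^{-1}(x+\phi_L(x)y)$. The fundamental multivariate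 Alexander quandle $Q_A(L)$ is the smallest subquandle of $U(L)$ containing $\gamma_D(a)$ for all $a\in A(D)$. Up to isomorphism these do not depend on $D$. *)

theory Defs
  imports
    "HOL-Analysis.Analysis"
    "HOL-Library.Poly_Mapping"
    "HOL-Algebra.Module"
    "HOL-Algebra.AbelCoset"
begin

section \<open>Links and their diagrams\<close>

text \<open>
  A link with components indexed by \<open>'m\<close> is a family of closed curves \<open>K i\<close> in the unit
  sphere of \<open>\<real>\<^sup>4\<close>.  Each curve is a function of period 1 on the line, so that the base point
  of the circle \<open>\<real>/\<int>\<close> plays no special role, and it is oriented by increasing parameter.
\<close>

definition smooth_arc :: "(real \<Rightarrow> 'a::real_normed_vector) \<Rightarrow> real \<Rightarrow> real \<Rightarrow> bool" where
  "smooth_arc g a b \<longleftrightarrow>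
     (\<exists>d :: nat \<Rightarrow> real \<Rightarrow> 'a. d 0 = g \<and>
        (\<forall>k. \<forall>t\<in>{a..b}. (d k has_vector_derivative d (Suc k) t) (at t within {a..b})) \<and>
        (\<forall>t\<in>{a..b}. d 1 t \<noteq> 0))"

definition piecewise_smooth :: "(real \<Rightarrow> 'a::real_normed_vector) \<Rightarrow> bool" where
  "piecewise_smooth g \<longleftrightarrow>
     (\<exists>S. finite S \<and> {0, 1} \<subseteq> S \<and> S \<subseteq> {0..1} \<and>
        (\<forall>a\<in>S. \<forall>b\<in>S. a < b \<and> {a<..<b} \<inter> S = {} \<longrightarrow> smooth_arc g a b))"

text \<open>
  The last clause gives at once the period 1, the injectivity of each \<open>K i\<close> on the circle and
  the disjointness of different components.
\<close>

definition link :: "('m \<Rightarrow> real \<Rightarrow> real^4) \<Rightarrow> bool" where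
  "link K \<longleftrightarrow>
     (\<forall>i. piecewise_smooth (K i)) \<and>
     (\<forall>i t. K i t \<in> sphere 0 1) \<and>
     (\<forall>i s j t. K i s = K j t \<longleftrightarrow> i = j \<and> s - t \<in> \<int>)"

text \<open>
  Stereographic projection from the pole \<open>axis 4 1\<close>; it preserves the orientation when the
  sphere is oriented as the boundary of the unit ball.
\<close>

definition stereo :: "real^4 \<Rightarrow> real^3" where
  "stereo x = (1 / (1 - x$4)) *\<^sub>R vector [x$1, x$2, x$3]"

text \<open>
  A diagram is given by the link positioned in \<open>\<real>\<^sup>3\<close>, to be projected along the third
  coordinate and viewed from above, and by half the parameter length of the
  segments that are removed at underpasses.
\<close>

record 'm diagram =
  space_curve :: "'m \<Rightarrow> real \<Rightarrow> real^3"
  gap :: real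

definition shadow :: "'m diagram \<Rightarrow> 'm \<Rightarrow> real \<Rightarrow> real^2" where
  "shadow D i t = vector [space_curve D i t $ 1, space_curve D i t $ 2]"

definition height :: "'m diagram \<Rightarrow> 'm \<Rightarrow> real \<Rightarrow> real" where
  "height D i t = space_curve D i t $ 3"

definition double_point :: "'m diagram \<Rightarrow> 'm \<Rightarrow> real \<Rightarrow> 'm \<Rightarrow> real \<Rightarrow> bool" where
  "double_point D i s j t \<longleftrightarrow> shadow D i s = shadow D j t \<and> \<not> (i = j \<and> s - t \<in> \<int>)"

definition over_under :: "'m diagram \<Rightarrow> 'm \<Rightarrow> real \<Rightarrow> 'm \<Rightarrow> real \<Rightarrow> bool" where
  "over_under D i s j t \<longleftrightarrow> double_point D i s j t \<and> height D i s > height D j t"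

definition crossings :: "'m diagram \<Rightarrow> (real^2) set" where
  "crossings D = {shadow D i s | i s. \<exists>j t. double_point D i s j t}"

definition regular_projection :: "'m diagram \<Rightarrow> bool" where
  "regular_projection D \<longleftrightarrow>
     (\<forall>i. piecewise_smooth (shadow D i)) \<and>
     finite (crossings D) \<and>
     (\<forall>i s j t k u. double_point D i s j t \<and> double_point D i s k u \<longrightarrow> j = k \<and> t - u \<in> \<int>) \<and>
     (\<forall>i s j t. double_point D i s j t \<longrightarrow>
        (\<exists>v w. (shadow D i has_vector_derivative v) (at s) \<and>
               (shadow D j has_vector_derivative w) (at t) \<and>
               det (vector [v, w] :: real^2^2) \<noteq> 0))"

text \<open>
  The removed segments are short: the closed segments are pairwise disjoint, and none of them
  contains a crossing parameter other than its own midpoint.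
\<close>

definition short_gap :: "'m diagram \<Rightarrow> bool" where
  "short_gap D \<longleftrightarrow> 0 < gap D \<and>
     (\<forall>i s j t k u r. over_under D i s j t \<and> double_point D j r k u \<and> r \<noteq> t \<longrightarrow>
        \<bar>r - t\<bar> > 2 * gap D)"

text \<open>
  The rotation moves an arbitrary point off the link to the pole of the stereographic
  projection and an arbitrary direction of projection to the vertical one.
\<close>

definition diagram_of :: "'m diagram \<Rightarrow> ('m \<Rightarrow> real \<Rightarrow> real^4) \<Rightarrow> bool" where
  "diagram_of D K \<longleftrightarrow>
     (\<exists>R :: real^4^4. rotation_matrix R \<and>
        (\<forall>i t. R *v K i t \<noteq> axis 4 1) \<and>
        space_curve D = (\<lambda>i t. stereo (R *v K i t))) \<and>
     regular_projection D \<and> short_gap D"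

definition picture :: "'m diagram \<Rightarrow> (real^2) set" where
  "picture D =
     {shadow D j r | j r. \<forall>i s t. over_under D i s j t \<longrightarrow> \<bar>r - t\<bar> \<ge> gap D}"

definition arcs :: "'m diagram \<Rightarrow> (real^2) set set" where
  "arcs D = components (picture D)"

definition arc_at :: "'m diagram \<Rightarrow> real^2 \<Rightarrow> (real^2) set" where
  "arc_at D p = connected_component_set (picture D) p"

definition kappa :: "'m diagram \<Rightarrow> (real^2) set \<Rightarrow> 'm" where
  "kappa D a = (THE i. a \<subseteq> range (shadow D i))"

definition over_arc :: "'m diagram \<Rightarrow> real^2 \<Rightarrow> (real^2) set" where
  "over_arc D c = arc_at D c"

text \<open>
  \<open>under_ends D c p q\<close>: the segment removed at the crossing \<open>c\<close> has end point \<open>p\<close> to the right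
  and end point \<open>q\<close> to the left of the overpass.  With \<open>v\<close> and \<open>w\<close> the velocities of the
  overpass and the underpass, the underpass runs from right to left iff \<open>(v, w)\<close> is a positive
  basis of the plane.
\<close>

definition under_ends :: "'m diagram \<Rightarrow> real^2 \<Rightarrow> real^2 \<Rightarrow> real^2 \<Rightarrow> bool" where
  "under_ends D c p q \<longleftrightarrow>
     (\<exists>i s j t v w. over_under D i s j t \<and> c = shadow D i s \<and>
        (shadow D i has_vector_derivative v) (at s) \<and>
        (shadow D j has_vector_derivative w) (at t) \<and>
        (if det (vector [v, w] :: real^2^2) > 0
         then p = shadow D j (t - gap D) \<and> q = shadow D j (t + gap D)
         else p = shadow D j (t + gap D) \<and> q = shadow D j (t - gap D)))"

definition right_arc :: "'m diagram \<Rightarrow> real^2 \<Rightarrow> (real^2) set" where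
  "right_arc D c = (THE a. \<exists>p q. under_ends D c p q \<and> a = arc_at D p)"

definition left_arc :: "'m diagram \<Rightarrow> real^2 \<Rightarrow> (real^2) set" where
  "left_arc D c = (THE a. \<exists>p q. under_ends D c p q \<and> a = arc_at D q)"

definition reindex :: "('m \<Rightarrow> 'n) \<Rightarrow> 'n diagram \<Rightarrow> 'm diagram" where
  "reindex \<sigma> D = \<lparr>space_curve = (\<lambda>i. space_curve D (\<sigma> i)), gap = gap D\<rparr>"


section \<open>Quandles\<close>

text \<open>\<open>x \<triangleleft> y\<close> stands for \<open>x \<triangleright>\<^sup>-\<^sup>1 y\<close>.\<close>

record 'a quandle = "'a partial_object" +
  qop :: "'a \<Rightarrow> 'a \<Rightarrow> 'a" (infixl \<open>\<triangleright>\<index>\<close> 70)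
  qinv :: "'a \<Rightarrow> 'a \<Rightarrow> 'a" (infixl \<open>\<triangleleft>\<index>\<close> 70)

locale quandle =
  fixes Q (structure)
  assumes qop_closed: "\<lbrakk>x \<in> carrier Q; y \<in> carrier Q\<rbrakk> \<Longrightarrow> x \<triangleright> y \<in> carrier Q"
    and qinv_closed: "\<lbrakk>x \<in> carrier Q; y \<in> carrier Q\<rbrakk> \<Longrightarrow> x \<triangleleft> y \<in> carrier Q"
    and Q1: "x \<in> carrier Q \<Longrightarrow> x \<triangleright> x = x"
    and Q2: "\<lbrakk>x \<in> carrier Q; y \<in> carrier Q\<rbrakk> \<Longrightarrow> (x \<triangleright> y) \<triangleleft> y = x"
    and Q2': "\<lbrakk>x \<in> carrier Q; y \<in> carrier Q\<rbrakk> \<Longrightarrow> (x \<triangleleft> y) \<triangleright> y = x"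
    and Q3: "\<lbrakk>x \<in> carrier Q; y \<in> carrier Q; z \<in> carrier Q\<rbrakk>
               \<Longrightarrow> (x \<triangleright> y) \<triangleright> z = (x \<triangleright> z) \<triangleright> (y \<triangleright> z)"

definition quandle_isomorphic :: "('a, 'c) quandle_scheme \<Rightarrow> ('b, 'd) quandle_scheme \<Rightarrow> bool"
    (infix \<open>\<cong>\<^sub>Q\<close> 60) where
  "Q \<cong>\<^sub>Q Q' \<longleftrightarrow>
     (\<exists>f. bij_betw f (carrier Q) (carrier Q') \<and>
        (\<forall>x\<in>carrier Q. \<forall>y\<in>carrier Q.
           f (x \<triangleright>\<^bsub>Q\<^esub> y) = f x \<triangleright>\<^bsub>Q'\<^esub> f y \<and> f (x \<triangleleft>\<^bsub>Q\<^esub> y) = f x \<triangleleft>\<^bsub>Q'\<^esub> f y))"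

definition subquandle :: "'a set \<Rightarrow> ('a, 'c) quandle_scheme \<Rightarrow> bool" where
  "subquandle H Q \<longleftrightarrow> H \<subseteq> carrier Q \<and> quandle (Q\<lparr>carrier := H\<rparr>)"

definition generated_subquandle ::
    "'a set \<Rightarrow> ('a, 'c) quandle_scheme \<Rightarrow> ('a, 'c) quandle_scheme" where
  "generated_subquandle X Q = Q\<lparr>carrier := \<Inter>{H. subquandle H Q \<and> X \<subseteq> H}\<rparr>"

text \<open>Quandle presentations: terms in the generators modulo the least quandle congruence.\<close>

datatype 'a qterm =
  Gen 'a
| Op "'a qterm" "'a qterm"
| OpInv "'a qterm" "'a qterm"

definition qterms :: "'a set \<Rightarrow> 'a qterm set" where
  "qterms A = {s. set_qterm s \<subseteq> A}"

inductive qcong :: "'a set \<Rightarrow> ('a qterm \<times> 'a qterm) set \<Rightarrow> 'a qterm \<Rightarrow> 'a qterm \<Rightarrow> bool"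
  for A R where
  rel: "\<lbrakk>(s, t) \<in> R; s \<in> qterms A; t \<in> qterms A\<rbrakk> \<Longrightarrow> qcong A R s t"
| refl: "s \<in> qterms A \<Longrightarrow> qcong A R s s"
| sym: "qcong A R s t \<Longrightarrow> qcong A R t s"
| trans: "\<lbrakk>qcong A R s t; qcong A R t u\<rbrakk> \<Longrightarrow> qcong A R s u"
| Op: "\<lbrakk>qcong A R s s'; qcong A R t t'\<rbrakk> \<Longrightarrow> qcong A R (Op s t) (Op s' t')"
| OpInv: "\<lbrakk>qcong A R s s'; qcong A R t t'\<rbrakk> \<Longrightarrow> qcong A R (OpInv s t) (OpInv s' t')"
| Q1: "s \<in> qterms A \<Longrightarrow> qcong A R (Op s s) s"
| Q2: "\<lbrakk>s \<in> qterms A; t \<in> qterms A\<rbrakk> \<Longrightarrow> qcong A R (OpInv (Op s t) t) s"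
| Q2': "\<lbrakk>s \<in> qterms A; t \<in> qterms A\<rbrakk> \<Longrightarrow> qcong A R (Op (OpInv s t) t) s"
| Q3: "\<lbrakk>s \<in> qterms A; t \<in> qterms A; u \<in> qterms A\<rbrakk>
         \<Longrightarrow> qcong A R (Op (Op s t) u) (Op (Op s u) (Op t u))"

definition qcong_rel :: "'a set \<Rightarrow> ('a qterm \<times> 'a qterm) set \<Rightarrow> ('a qterm \<times> 'a qterm) set" where
  "qcong_rel A R = {(s, t). qcong A R s t}"

definition qclass :: "'a set \<Rightarrow> ('a qterm \<times> 'a qterm) set \<Rightarrow> 'a qterm \<Rightarrow> 'a qterm set" where
  "qclass A R s = qcong_rel A R `` {s}"

definition presented_quandle ::
    "'a set \<Rightarrow> ('a qterm \<times> 'a qterm) set \<Rightarrow> 'a qterm set quandle" where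
  "presented_quandle A R =
     \<lparr>carrier = qterms A // qcong_rel A R,
      qop = (\<lambda>X Y. \<Union>s\<in>X. \<Union>t\<in>Y. qclass A R (Op s t)),
      qinv = (\<lambda>X Y. \<Union>s\<in>X. \<Union>t\<in>Y. qclass A R (OpInv s t))\<rparr>"

lemma qcong_qterms: "qcong A R s t \<Longrightarrow> s \<in> qterms A \<and> t \<in> qterms A"
  by (induction rule: qcong.induct) (auto simp: qterms_def)

lemma equiv_qcong_rel: "equiv (qterms A) (qcong_rel A R)"
  by (rule equivI)
     (auto simp: qcong_rel_def refl_on_def sym_on_def trans_on_def
           intro: qcong.refl qcong.sym qcong.trans dest: qcong_qterms)

lemma qclass_eq: "qcong A R s t \<Longrightarrow> qclass A R s = qclass A R t"
  unfolding qclass_def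
  by (rule equiv_class_eq[OF equiv_qcong_rel]) (simp add: qcong_rel_def)

lemma mem_qclass: "t \<in> qclass A R s \<longleftrightarrow> qcong A R s t"
  by (simp add: qclass_def qcong_rel_def)

lemma presented_quandle_ops:
  assumes "s \<in> qterms A" and "t \<in> qterms A"
  shows "qop (presented_quandle A R) (qclass A R s) (qclass A R t) = qclass A R (Op s t)"
    and "qinv (presented_quandle A R) (qclass A R s) (qclass A R t) = qclass A R (OpInv s t)"
proof -
  have ne: "s \<in> qclass A R s" "t \<in> qclass A R t"
    unfolding mem_qclass by (rule qcong.refl, fact)+
  have "qclass A R (Op u v) = qclass A R (Op s t)"
    if "u \<in> qclass A R s" "v \<in> qclass A R t" for u v
    using that by (metis mem_qclass qclass_eq qcong.Op)
  with ne show "qop (presented_quandle A R) (qclass A R s) (qclass A R t) = qclass A R (Op s t)"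
    unfolding presented_quandle_def quandle.simps by blast
  have "qclass A R (OpInv u v) = qclass A R (OpInv s t)"
    if "u \<in> qclass A R s" "v \<in> qclass A R t" for u v
    using that by (metis mem_qclass qclass_eq qcong.OpInv)
  with ne show "qinv (presented_quandle A R) (qclass A R s) (qclass A R t) = qclass A R (OpInv s t)"
    unfolding presented_quandle_def quandle.simps by blast
qed

lemma quandle_presented_quandle: "quandle (presented_quandle A R)"
proof -
  have carr: "carrier (presented_quandle A R) = qclass A R ` qterms A"
    by (auto simp: presented_quandle_def quotient_def qclass_def)
  have closed: "Op s t \<in> qterms A" "OpInv s t \<in> qterms A"
    if "s \<in> qterms A" "t \<in> qterms A" for s t
    using that by (auto simp: qterms_def)
  show ?thesis
    by (rule quandle.intro; unfold carr; elim imageE; hypsubst)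
       (simp_all add: presented_quandle_ops closed qclass_eq
          qcong.Q1 qcong.Q2 qcong.Q2' qcong.Q3)
qed

definition fundamental_quandle :: "'m diagram \<Rightarrow> (real^2) set qterm set quandle" where
  "fundamental_quandle D = presented_quandle (arcs D)
     ((\<lambda>c. (Op (Gen (right_arc D c)) (Gen (over_arc D c)), Gen (left_arc D c))) ` crossings D \<union>
      (\<lambda>c. (OpInv (Gen (left_arc D c)) (Gen (over_arc D c)), Gen (right_arc D c))) ` crossings D)"


section \<open>Alexander modules\<close>

text \<open>
  Laurent polynomials in variables indexed by \<open>'m\<close> with integer coefficients: the group ring
  of the free abelian group of exponents \<open>'m \<Rightarrow>\<^sub>0 int\<close>.
\<close>

type_synonym 'm laurent = "('m \<Rightarrow>\<^sub>0 int) \<Rightarrow>\<^sub>0 int"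

definition tvar :: "'m \<Rightarrow> 'm laurent" where
  "tvar i = Poly_Mapping.single (Poly_Mapping.single i 1) 1"

definition Lambda :: "'m laurent ring" where
  "Lambda = \<lparr>carrier = UNIV, mult = (*), one = 1, zero = 0, add = (+)\<rparr>"

lemma cring_Lambda: "cring (Lambda :: 'm laurent ring)"
proof (rule cringI)
  show "abelian_group (Lambda :: 'm laurent ring)"
  proof (rule abelian_groupI)
    fix x :: "'m laurent"
    show "\<exists>y\<in>carrier Lambda. y \<oplus>\<^bsub>Lambda\<^esub> x = \<zero>\<^bsub>Lambda\<^esub>"
      by (rule bexI[of _ "- x"]) (simp_all add: Lambda_def)
  qed (simp_all add: Lambda_def algebra_simps)
  show "comm_monoid (Lambda :: 'm laurent ring)"
    by (rule comm_monoidI) (simp_all add: Lambda_def algebra_simps)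
qed (simp add: Lambda_def algebra_simps)

text \<open>
  The free module with basis \<open>A\<close>, for finite \<open>A\<close>.  The fields \<open>mult\<close> and \<open>one\<close> play no role in
  a module record.
\<close>

definition free_module :: "'a set \<Rightarrow> ('m laurent, 'a \<Rightarrow> 'm laurent) module" where
  "free_module A =
     \<lparr>carrier = {v. \<forall>a. a \<notin> A \<longrightarrow> v a = 0}, mult = undefined, one = undefined,
      zero = (\<lambda>a. 0), add = (\<lambda>v w a. v a + w a), smult = (\<lambda>r v a. r * v a)\<rparr>"

definition quotient_module :: "('r, 'a) module \<Rightarrow> 'a set \<Rightarrow> ('r, 'a set) module" where
  "quotient_module M N =
     \<lparr>carrier = a_rcosets\<^bsub>M\<^esub> N, mult = undefined, one = undefined,
      zero = N, add = set_add M, smult = (\<lambda>r X. \<Union>x\<in>X. N +>\<^bsub>M\<^esub> (r \<odot>\<^bsub>M\<^esub> x))\<rparr>"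

definition linear_iso :: "('r, 'b) ring_scheme \<Rightarrow> ('r, 'x) module \<Rightarrow> ('r, 'y) module \<Rightarrow> ('x \<Rightarrow> 'y) set" where
  "linear_iso R M N =
     {f. bij_betw f (carrier M) (carrier N) \<and>
         (\<forall>x\<in>carrier M. \<forall>y\<in>carrier M. f (x \<oplus>\<^bsub>M\<^esub> y) = f x \<oplus>\<^bsub>N\<^esub> f y) \<and>
         (\<forall>r\<in>carrier R. \<forall>x\<in>carrier M. f (r \<odot>\<^bsub>M\<^esub> x) = r \<odot>\<^bsub>N\<^esub> f x)}"

definition relator :: "'m diagram \<Rightarrow> real^2 \<Rightarrow> (real^2) set \<Rightarrow> 'm laurent" where
  "relator D c =
     (let a1 = over_arc D c; a2 = right_arc D c; a3 = left_arc D c in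
       (\<lambda>a. (1 - tvar (kappa D a2)) * of_bool (a = a1)
            + tvar (kappa D a1) * of_bool (a = a2) - of_bool (a = a3)))"

definition rho :: "'m diagram \<Rightarrow> (real^2 \<Rightarrow> 'm laurent) \<Rightarrow> (real^2) set \<Rightarrow> 'm laurent" where
  "rho D w = (\<lambda>a. \<Sum>c\<in>crossings D. w c * relator D c a)"

definition rho_image :: "'m diagram \<Rightarrow> ((real^2) set \<Rightarrow> 'm laurent) set" where
  "rho_image D = rho D ` carrier (free_module (crossings D))"

definition alexander_module ::
    "'m diagram \<Rightarrow> ('m laurent, ((real^2) set \<Rightarrow> 'm laurent) set) module" where
  "alexander_module D = quotient_module (free_module (arcs D)) (rho_image D)"

definition gamma :: "'m diagram \<Rightarrow> ((real^2) set \<Rightarrow> 'm laurent) \<Rightarrow> ((real^2) set \<Rightarrow> 'm laurent) set" where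
  "gamma D v = rho_image D +>\<^bsub>free_module (arcs D)\<^esub> v"

definition gamma_arc :: "'m diagram \<Rightarrow> (real^2) set \<Rightarrow> ((real^2) set \<Rightarrow> 'm laurent) set" where
  "gamma_arc D a = gamma D (\<lambda>b. of_bool (b = a))"

text \<open>
  The linear map with \<open>\<phi> (\<gamma> a) = t\<^bsub>\<kappa> a\<^esub> - 1\<close>: its value on a coset is the common value on
  representatives of the map that sends the basis element \<open>a\<close> to \<open>t\<^bsub>\<kappa> a\<^esub> - 1\<close>.  Its image is the
  augmentation ideal; it is regarded here as a map into the whole ring.
\<close>

definition phi :: "'m diagram \<Rightarrow> ((real^2) set \<Rightarrow> 'm laurent) set \<Rightarrow> 'm laurent" where
  "phi D x = the_elem ((\<lambda>v. \<Sum>a\<in>arcs D. v a * (tvar (kappa D a) - 1)) ` x)"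

definition module_sequences_equivalent :: "'m diagram \<Rightarrow> 'm diagram \<Rightarrow> bool" where
  "module_sequences_equivalent D D' \<longleftrightarrow>
     (\<exists>f \<in> linear_iso Lambda (alexander_module D) (alexander_module D').
        \<forall>x\<in>carrier (alexander_module D). phi D x = phi D' (f x))"

definition total_alexander_quandle ::
    "'m diagram \<Rightarrow> ((real^2) set \<Rightarrow> 'm laurent) set quandle" where
  "total_alexander_quandle D =
     (let M = alexander_module D; \<phi> = phi D in
       \<lparr>carrier = {x \<in> carrier M. \<phi> x + 1 \<in> Units Lambda},
        qop = (\<lambda>x y. ((\<phi> y + 1) \<odot>\<^bsub>M\<^esub> x) \<ominus>\<^bsub>M\<^esub> (\<phi> x \<odot>\<^bsub>M\<^esub> y)),
        qinv = (\<lambda>x y. (inv\<^bsub>Lambda\<^esub> (\<phi> y + 1)) \<odot>\<^bsub>M\<^esub> (x \<oplus>\<^bsub>M\<^esub> (\<phi> x \<odot>\<^bsub>M\<^esub> y)))\<rparr>)"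

definition fundamental_alexander_quandle ::
    "'m diagram \<Rightarrow> ((real^2) set \<Rightarrow> 'm laurent) set quandle" where
  "fundamental_alexander_quandle D =
     generated_subquandle (gamma_arc D ` arcs D) (total_alexander_quandle D)"

end

theory Submission
  imports Defs
begin

text \<open>
  Let \<open>Q\<close> be either \<open>Q(L)\<close> or \<open>Q\<^sub>A(L)\<close>, with its canonical map \<open>p\<close> to \<open>Q\<^sub>A(L)\<close>, and let
  \<open>g : Q \<rightarrow> Q'\<close> be an isomorphism.  The assignment \<open>a \<mapsto> p' (g a)\<close> colours the arcs of \<open>L\<close> by
  \<open>Q\<^sub>A(L')\<close>.  The operations preserve \<open>\<phi>'\<close>, and successive arcs of one component differ by an
  operation, so \<open>\<phi>'\<close> of the colour is \<open>t\<^bsub>\<sigma> i\<^esub> - 1\<close>, where \<open>i\<close> is the component of the arc.  Since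
  \<open>x \<triangleright> y = t\<^bsub>\<kappa> y\<^esub> x + (1 - t\<^bsub>\<kappa> x\<^esub>) y\<close> in \<open>Q\<^sub>A(L')\<close>, the relation at a crossing says precisely that the
  colouring kills \<open>\<rho>\<^sub>D(c)\<close>, so it extends to a semilinear map \<open>M\<^sub>A(L) \<rightarrow> M\<^sub>A(L')\<close> compatible with
  \<open>\<phi>\<close>.  The inverse of \<open>g\<close> yields the inverse map.  This proves that 1 or 2 implies 3, by an
  isomorphism that carries \<open>Q\<^sub>A(L)\<close> onto \<open>Q\<^sub>A(L')\<close>, hence also that 1 implies 2.  The quandle
  \<open>U(L)\<close> is defined in terms of the link module sequence alone, so 3 implies 4.
\<close>

text \<open>An abstract isomorphism knows neither arcs nor components: the image of a generator need
  not come from an arc of the other diagram. Components are therefore read off from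
  \<open>phi\<close>. On \<open>QA\<close> the value \<open>phi + 1\<close> is always a single
  variable, and distinct variables are distinct ring elements. This determines the component map
  \<open>\<sigma>\<close>, and following one generator there and back shows that the map for the
  inverse isomorphism inverts \<open>\<sigma>\<close>. The projection of Q(L) onto \<open>QA\<close>
  need not be injective, so an isomorphism of fundamental quandles cannot simply be pushed down. The
  module map is built first; that it commutes with the projections is then an induction over the
  quandle. The two coefficient rings have different variables, which is why the maps are semilinear.
  Composition with the tautological semilinear isomorphism between \<open>D'\<close> and
  \<open>reindex \<sigma> D'\<close> gives the linear statement. On the geometric side,
  \<open>kappa\<close> is defined by containment in a plane curve. It must be excluded that an arc
  also lies in the shadow of another component, and that removed segments interfere with each other
  or with overpasses; the factor 2 in \<open>short_gap\<close> serves the latter.\<close>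

section \<open>Laurent polynomials and relabelling of variables\<close>

text \<open>\<open>map_key\<close> precomposes with its argument, so an exponent of the image is pulled back along \<open>\<sigma>\<close>;
  the result is the substitution \<open>t\<^sub>i \<mapsto> t\<^bsub>\<sigma> i\<^esub>\<close> for bijective \<open>\<sigma>\<close> only.\<close>

definition relabel :: "('m \<Rightarrow> 'n) \<Rightarrow> 'm laurent \<Rightarrow> 'n laurent" where
  "relabel \<sigma> = Poly_Mapping.map_key (Poly_Mapping.map_key \<sigma>)"

lemma map_key_inverse:
  assumes "bij \<sigma>"
  shows "Poly_Mapping.map_key (inv_into UNIV \<sigma>) (Poly_Mapping.map_key \<sigma> p) = p"
    and "Poly_Mapping.map_key \<sigma> (Poly_Mapping.map_key (inv_into UNIV \<sigma>) q) = q"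
proof -
  have i: "inj \<sigma>" "inj (inv_into UNIV \<sigma>)" "\<sigma> \<circ> inv_into UNIV \<sigma> = id" "inv_into UNIV \<sigma> \<circ> \<sigma> = id"
    using assms by (auto simp: bij_def surj_imp_inj_inv surj_iff)
  show "Poly_Mapping.map_key (inv_into UNIV \<sigma>) (Poly_Mapping.map_key \<sigma> p) = p"
    "Poly_Mapping.map_key \<sigma> (Poly_Mapping.map_key (inv_into UNIV \<sigma>) q) = q"
    using i by (simp_all add: map_key_compose map_key_id id_def)
qed

text \<open>The laws of \<open>map_key\<close> ask for an injective map of keys; in
  \<open>relabel\<close> the keys are exponents, and their map is itself a
  \<open>map_key\<close>.\<close>

lemma inj_map_key:
  assumes "bij \<sigma>"
  shows "inj (Poly_Mapping.map_key \<sigma>)"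
  by (rule inj_on_inverseI) (rule map_key_inverse(1)[OF assms])

lemma inv_map_key:
  assumes "bij \<sigma>"
  shows "bij (Poly_Mapping.map_key \<sigma>)" "inv_into UNIV (Poly_Mapping.map_key \<sigma>) = Poly_Mapping.map_key (inv_into UNIV \<sigma>)"
proof -
  show "inv_into UNIV (Poly_Mapping.map_key \<sigma>) = Poly_Mapping.map_key (inv_into UNIV \<sigma>)"
    using assms by (intro inv_equality map_key_inverse)
  show "bij (Poly_Mapping.map_key \<sigma>)"
    by (rule o_bij[of "Poly_Mapping.map_key (inv_into UNIV \<sigma>)"]) (simp_all add: fun_eq_iff map_key_inverse[OF assms])
qed

lemma relabel_inverse:
  assumes "bij \<sigma>"
  shows "relabel (inv_into UNIV \<sigma>) (relabel \<sigma> p) = p" "relabel \<sigma> (relabel (inv_into UNIV \<sigma>) q) = q"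
proof -
  have "bij (inv_into UNIV \<sigma>)" using assms by (rule bij_imp_bij_inv)
  then show "relabel (inv_into UNIV \<sigma>) (relabel \<sigma> p) = p" "relabel \<sigma> (relabel (inv_into UNIV \<sigma>) q) = q"
    using map_key_inverse[OF inv_map_key(1)[OF assms]]
    by (simp_all add: relabel_def inv_map_key(2)[OF assms])
qed

lemma map_key_id_eq_id: "Poly_Mapping.map_key id = id"
  by (simp add: fun_eq_iff map_key_id id_def)

lemma relabel_id: "relabel id p = p"
  by (simp add: relabel_def map_key_id_eq_id)

lemma poly_mapping_single_induct [case_names zero add]:
  assumes "P 0" and "\<And>k v p. P p \<Longrightarrow> P (Poly_Mapping.single k v + p)"
  shows "P p"
proof (induction p rule: update_induct)
  case const
  have "(0 :: 'a \<Rightarrow>\<^sub>0 'b) = Abs_poly_mapping (\<lambda>_. 0)" by transfer simp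
  with assms(1) show ?case by simp
next
  case (update p k v)
  \<comment> \<open>The key \<open>k\<close> is new to \<open>p\<close>, so overwriting its value
    amounts to adding a monomial.\<close>
  have "Poly_Mapping.update k v p = Poly_Mapping.single k v + p"
    using update by (intro poly_mapping_eqI) (auto simp: lookup_update lookup_add lookup_single in_keys_iff when_def)
  with update assms(2) show ?case by simp
qed

context
  fixes \<sigma> :: "'m \<Rightarrow> 'n"
  assumes bij: "bij \<sigma>"
begin

lemma relabel_add: "relabel \<sigma> (p + q) = relabel \<sigma> p + relabel \<sigma> q"
  unfolding relabel_def by (rule map_key_plus[OF inj_map_key[OF bij]])

lemma relabel_zero: "relabel \<sigma> 0 = 0"
  unfolding relabel_def by (rule map_key_zero[OF inj_map_key[OF bij]])

lemma relabel_single: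
  "relabel \<sigma> (Poly_Mapping.single e c) = Poly_Mapping.single (Poly_Mapping.map_key (inv_into UNIV \<sigma>) e) c"
  unfolding relabel_def
  \<comment> \<open>\<open>map_key_single\<close> applies once the exponent \<open>e\<close> is
    written as the pullback along \<open>\<sigma>\<close> of its pullback along the inverse.\<close>
  by (metis map_key_single[OF inj_map_key[OF bij]] map_key_inverse(2)[OF bij])

text \<open>Both sides are additive in each factor, so monomials suffice; there, exponents add and
  relabelling of exponents is additive.\<close>

lemma relabel_mult: "relabel \<sigma> (p * q) = relabel \<sigma> p * relabel \<sigma> q"
proof (induction p rule: poly_mapping_single_induct)
  case (add e c p)
  have "relabel \<sigma> (Poly_Mapping.single e c * q) = relabel \<sigma> (Poly_Mapping.single e c) * relabel \<sigma> q"
  proof (induction q rule: poly_mapping_single_induct)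
    case (add e' c' q)
    have "inj (inv_into UNIV \<sigma>)" using bij by (simp add: bij_def surj_imp_inj_inv)
    then show ?case using add
      by (simp add: distrib_left relabel_add mult_single relabel_single map_key_plus)
  qed (simp add: relabel_zero)
  with add show ?case by (simp add: distrib_right relabel_add)
qed (simp add: relabel_zero)

lemma relabel_tvar: "relabel \<sigma> (tvar i) = tvar (\<sigma> i)"
proof -
  have "inj (inv_into UNIV \<sigma>)" using bij by (simp add: bij_def surj_imp_inj_inv)
  from map_key_single[OF this, of "\<sigma> i" "1 :: int"] show ?thesis
    using bij by (simp add: tvar_def relabel_single bij_def)
qed

lemma relabel_one: "relabel \<sigma> 1 = 1"
proof -
  have "inj (inv_into UNIV \<sigma>)" using bij by (simp add: bij_def surj_imp_inj_inv)
  then show ?thesis unfolding single_one[symmetric] relabel_single by simp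
qed

lemma relabel_minus: "relabel \<sigma> (- p) = - relabel \<sigma> p"
  by (rule minus_unique[symmetric]) (simp add: relabel_add[symmetric] relabel_zero)

lemma relabel_diff: "relabel \<sigma> (p - q) = relabel \<sigma> p - relabel \<sigma> q"
  using relabel_add[of p "- q"] by (simp add: relabel_minus)

lemma relabel_sum: "relabel \<sigma> (sum f A) = (\<Sum>x\<in>A. relabel \<sigma> (f x))"
  by (induction A rule: infinite_finite_induct) (simp_all add: relabel_zero relabel_add)

lemmas relabel_simps =
  relabel_add relabel_mult relabel_zero relabel_one relabel_minus relabel_diff relabel_tvar

end

text \<open>This is what allows a component to be recovered from a value of
  \<open>phi\<close>.\<close>

lemma tvar_eq_iff: "tvar i = tvar j \<longleftrightarrow> i = j"
proof
  assume "tvar i = tvar j"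
  then have "Poly_Mapping.lookup (tvar i) (Poly_Mapping.single j 1) = 1"
    by (simp add: tvar_def)
  then have "Poly_Mapping.single i (1::int) = Poly_Mapping.single j 1"
    by (simp add: tvar_def lookup_single when_def split: if_splits)
  then have "Poly_Mapping.lookup (Poly_Mapping.single i (1::int)) j = 1"
    by simp
  then show "i = j"
    by (simp add: lookup_single when_def split: if_splits)
qed simp

section \<open>Units of the Laurent polynomial ring\<close>

lemma Lambda_simps:
  "carrier Lambda = UNIV" "p \<otimes>\<^bsub>Lambda\<^esub> q = p * q" "\<one>\<^bsub>Lambda\<^esub> = 1"
  by (simp_all add: Lambda_def)

lemma Units_Lambda_iff: "u \<in> Units Lambda \<longleftrightarrow> (\<exists>v. v * u = 1)"
proof -
  have "v * u = 1 \<and> u * v = 1 \<longleftrightarrow> v * u = 1" for v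
    by (metis mult.commute)
  then show ?thesis
    unfolding Units_def Lambda_simps by simp
qed

lemma inv_Lambda: "u \<in> Units Lambda \<Longrightarrow> inv\<^bsub>Lambda\<^esub> u * u = 1"
proof -
  interpret cring "Lambda :: 'a laurent ring" by (rule cring_Lambda)
  assume "u \<in> Units (Lambda :: 'a laurent ring)"
  then show ?thesis using Units_l_inv unfolding Lambda_simps by blast
qed

lemma inv_Lambda_eqI:
  assumes "v * u = 1"
  shows "inv\<^bsub>Lambda\<^esub> u = v"
proof -
  have "u \<in> Units Lambda" unfolding Units_Lambda_iff using assms by blast
  have "inv\<^bsub>Lambda\<^esub> u = inv\<^bsub>Lambda\<^esub> u * (u * v)"
    by (simp only: mult.commute[of u v] assms mult_1_right)
  also have "\<dots> = v"
    by (simp only: mult.assoc[symmetric] inv_Lambda[OF \<open>u \<in> Units Lambda\<close>] mult_1_left)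
  finally show ?thesis .
qed

lemma tvar_in_Units: "tvar i \<in> Units Lambda"
proof -
  have "Poly_Mapping.single (Poly_Mapping.single i (-1)) 1 * tvar i = 1"
    unfolding tvar_def mult_single by (simp flip: single_add)
  then show ?thesis unfolding Units_Lambda_iff by blast
qed

lemma relabel_Units:
  assumes "bij \<sigma>" and "u \<in> Units Lambda"
  shows "relabel \<sigma> u \<in> Units Lambda" "inv\<^bsub>Lambda\<^esub> (relabel \<sigma> u) = relabel \<sigma> (inv\<^bsub>Lambda\<^esub> u)"
proof -
  have *: "relabel \<sigma> (inv\<^bsub>Lambda\<^esub> u) * relabel \<sigma> u = 1"
    by (simp only: inv_Lambda[OF assms(2)] relabel_mult[OF assms(1), symmetric] relabel_one[OF assms(1)])
  then show "relabel \<sigma> u \<in> Units Lambda"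
    unfolding Units_Lambda_iff by blast
  from * show "inv\<^bsub>Lambda\<^esub> (relabel \<sigma> u) = relabel \<sigma> (inv\<^bsub>Lambda\<^esub> u)"
    by (rule inv_Lambda_eqI)
qed

section \<open>The Alexander module of a diagram\<close>

definition vectors :: "'m diagram \<Rightarrow> ((real^2) set \<Rightarrow> 'm laurent) set" where
  "vectors D = carrier (free_module (arcs D))"

text \<open>The lift of \<open>phi\<close> along \<open>gamma\<close> to the free module.\<close>

definition aug :: "'m diagram \<Rightarrow> ((real^2) set \<Rightarrow> 'm laurent) \<Rightarrow> 'm laurent" where
  "aug D v = (\<Sum>a\<in>arcs D. v a * (tvar (kappa D a) - 1))"

text \<open>All that the algebra needs to know about a diagram.  The last condition says that the arcs of a
  component are joined by steps from one side of an overpass to the other.\<close>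

locale tame_diagram =
  fixes D :: "'m diagram"
  assumes finite_arcs: "finite (arcs D)"
    and finite_crossings: "finite (crossings D)"
    and over_arc_in_arcs: "c \<in> crossings D \<Longrightarrow> over_arc D c \<in> arcs D"
    and right_arc_in_arcs: "c \<in> crossings D \<Longrightarrow> right_arc D c \<in> arcs D"
    and left_arc_in_arcs: "c \<in> crossings D \<Longrightarrow> left_arc D c \<in> arcs D"
    and kappa_left_arc: "c \<in> crossings D \<Longrightarrow> kappa D (left_arc D c) = kappa D (right_arc D c)"
    and kappa_unique: "a \<in> arcs D \<Longrightarrow> a \<subseteq> range (shadow D i) \<longleftrightarrow> i = kappa D a"
    and kappa_surj: "\<exists>a\<in>arcs D. kappa D a = i"
    and arcs_connected:
      "\<lbrakk>\<And>c. c \<in> crossings D \<Longrightarrow> P (right_arc D c) \<longleftrightarrow> P (left_arc D c);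
        a \<in> arcs D; b \<in> arcs D; kappa D a = kappa D b; P a\<rbrakk> \<Longrightarrow> P b"

section \<open>Cosets of the relator submodule, computed on representatives\<close>

lemma free_module_simps:
  "carrier (free_module A) = {v. \<forall>a. a \<notin> A \<longrightarrow> v a = 0}"
  "v \<oplus>\<^bsub>free_module A\<^esub> w = (\<lambda>a. v a + w a)"
  "\<zero>\<^bsub>free_module A\<^esub> = (\<lambda>a. 0)"
  "r \<odot>\<^bsub>free_module A\<^esub> v = (\<lambda>a. r * v a)"
  by (simp_all add: free_module_def)

lemma vectors_iff: "v \<in> vectors D \<longleftrightarrow> (\<forall>a. a \<notin> arcs D \<longrightarrow> v a = 0)"
  by (simp add: vectors_def free_module_simps)

lemma aug_add: "aug D (\<lambda>a. v a + w a) = aug D v + aug D w"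
  by (simp add: aug_def distrib_right sum.distrib)

lemma aug_smult: "aug D (\<lambda>a. r * v a) = r * aug D v"
  by (simp add: aug_def sum_distrib_left mult.assoc)

lemma aug_diff: "aug D (\<lambda>a. v a - w a) = aug D v - aug D w"
  by (simp add: aug_def left_diff_distrib sum_subtractf)

lemma aug_sum: "aug D (\<lambda>a. \<Sum>i\<in>I. v i a) = (\<Sum>i\<in>I. aug D (v i))"
  by (simp add: aug_def sum_distrib_right) (rule sum.swap)

text \<open>\<open>rho\<close> reads its argument at crossings only, so cutting off the other
  coefficients does not change the value.\<close>

lemma rho_image_eq: "rho_image D = range (rho D)"
proof -
  have "rho D w \<in> rho_image D" for w
  proof -
    have "rho D w = rho D (\<lambda>c. if c \<in> crossings D then w c else 0)"
      unfolding rho_def by (intro ext sum.cong) auto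
    then show ?thesis unfolding rho_image_def free_module_simps by auto
  qed
  then show ?thesis unfolding rho_image_def by auto
qed

lemma rho_image_zero: "(\<lambda>a. 0) \<in> rho_image D"
  unfolding rho_image_eq by (rule range_eqI[of _ _ "\<lambda>c. 0"]) (simp add: rho_def)

lemma rho_image_add:
  assumes "v \<in> rho_image D" and "w \<in> rho_image D"
  shows "(\<lambda>a. v a + w a) \<in> rho_image D"
proof -
  from assms obtain x y where "v = rho D x" "w = rho D y" unfolding rho_image_eq by blast
  then have "(\<lambda>a. v a + w a) = rho D (\<lambda>c. x c + y c)"
    by (simp add: rho_def distrib_right sum.distrib)
  then show ?thesis unfolding rho_image_eq by blast
qed

lemma rho_image_smult:
  assumes "v \<in> rho_image D"
  shows "(\<lambda>a. r * v a) \<in> rho_image D"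
proof -
  from assms obtain x where "v = rho D x" unfolding rho_image_eq by blast
  then have "(\<lambda>a. r * v a) = rho D (\<lambda>c. r * x c)"
    by (simp add: rho_def sum_distrib_left mult.assoc)
  then show ?thesis unfolding rho_image_eq by blast
qed

lemma rho_image_sum:
  assumes "\<And>i. i \<in> I \<Longrightarrow> v i \<in> rho_image D"
  shows "(\<lambda>a. \<Sum>i\<in>I. v i a) \<in> rho_image D"
  using assms
  by (induction I rule: infinite_finite_induct) (simp_all add: rho_image_zero rho_image_add)

lemma gamma_alt: "gamma D v = (\<lambda>n a. n a + v a) ` rho_image D"
  unfolding gamma_def a_r_coset_def' free_module_simps by auto

lemma gamma_eq_iff: "gamma D v = gamma D w \<longleftrightarrow> (\<lambda>a. v a - w a) \<in> rho_image D"
proof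
  assume "gamma D v = gamma D w"
  moreover have "v \<in> gamma D v"
    unfolding gamma_alt by (rule image_eqI[OF _ rho_image_zero]) simp
  ultimately obtain n where "n \<in> rho_image D" "v = (\<lambda>a. n a + w a)"
    unfolding gamma_alt by blast
  then show "(\<lambda>a. v a - w a) \<in> rho_image D" by simp
next
  have sub: "gamma D x \<subseteq> gamma D y" if "(\<lambda>a. x a - y a) \<in> rho_image D" for x y
  proof
    fix z assume "z \<in> gamma D x"
    then obtain n where n: "n \<in> rho_image D" "z = (\<lambda>a. n a + x a)"
      unfolding gamma_alt by blast
    from rho_image_add[OF n(1) that] show "z \<in> gamma D y"
      unfolding gamma_alt n(2) by (rule image_eqI[rotated]) (simp add: algebra_simps)
  qed
  assume 1: "(\<lambda>a. v a - w a) \<in> rho_image D"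
  have 2: "(\<lambda>a. w a - v a) \<in> rho_image D"
    using rho_image_smult[OF 1, of "-1"] by simp
  show "gamma D v = gamma D w" using sub[OF 1] sub[OF 2] by blast
qed

lemma mem_gamma_iff: "w \<in> gamma D v \<longleftrightarrow> gamma D w = gamma D v"
proof
  assume "w \<in> gamma D v"
  then show "gamma D w = gamma D v" unfolding gamma_eq_iff unfolding gamma_alt by auto
next
  assume "gamma D w = gamma D v"
  moreover have "w \<in> gamma D w"
    unfolding gamma_alt by (rule image_eqI[OF _ rho_image_zero]) simp
  ultimately show "w \<in> gamma D v" by simp
qed

lemma carrier_alexander_module: "carrier (alexander_module D) = gamma D ` vectors D"
  unfolding alexander_module_def quotient_module_def vectors_def A_RCOSETS_def' gamma_def by auto

lemma zero_alexander_module: "\<zero>\<^bsub>alexander_module D\<^esub> = gamma D (\<lambda>a. 0)"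
  unfolding alexander_module_def quotient_module_def gamma_alt by simp

lemma gamma_add_cong:
  assumes "gamma D v = gamma D v'" and "gamma D w = gamma D w'"
  shows "gamma D (\<lambda>a. v a + w a) = gamma D (\<lambda>a. v' a + w' a)"
  using rho_image_add[OF assms[unfolded gamma_eq_iff]]
  unfolding gamma_eq_iff by (simp add: algebra_simps)

lemma gamma_smult_cong:
  assumes "gamma D v = gamma D v'"
  shows "gamma D (\<lambda>a. r * v a) = gamma D (\<lambda>a. r * v' a)"
  using rho_image_smult[OF assms[unfolded gamma_eq_iff], of r]
  unfolding gamma_eq_iff by (simp add: algebra_simps)

lemma gamma_add: "gamma D v \<oplus>\<^bsub>alexander_module D\<^esub> gamma D w = gamma D (\<lambda>a. v a + w a)"
proof -
  have "gamma D v \<oplus>\<^bsub>alexander_module D\<^esub> gamma D w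
      = (\<Union>x\<in>gamma D v. \<Union>y\<in>gamma D w. {\<lambda>a. x a + y a})"
    unfolding alexander_module_def quotient_module_def
    by (simp add: set_add_def' free_module_simps)
  also have "\<dots> = gamma D (\<lambda>a. v a + w a)"
  proof (intro equalityI subsetI)
    fix z assume "z \<in> (\<Union>x\<in>gamma D v. \<Union>y\<in>gamma D w. {\<lambda>a. x a + y a})"
    then obtain x y where *: "x \<in> gamma D v" "y \<in> gamma D w" and z: "z = (\<lambda>a. x a + y a)" by blast
    show "z \<in> gamma D (\<lambda>a. v a + w a)"
      using gamma_add_cong[OF *[unfolded mem_gamma_iff]] unfolding z mem_gamma_iff .
  next
    fix z assume "z \<in> gamma D (\<lambda>a. v a + w a)"
    then obtain n where n: "n \<in> rho_image D" "z = (\<lambda>a. n a + (v a + w a))"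
      unfolding gamma_alt by blast
    have "(\<lambda>a. n a + v a) \<in> gamma D v" "w \<in> gamma D w"
      using n(1) unfolding gamma_alt by (auto intro!: image_eqI[OF _ rho_image_zero])
    moreover have "z = (\<lambda>a. (n a + v a) + w a)" using n(2) by (simp add: add.assoc)
    ultimately show "z \<in> (\<Union>x\<in>gamma D v. \<Union>y\<in>gamma D w. {\<lambda>a. x a + y a})" by blast
  qed
  finally show ?thesis .
qed

lemma gamma_smult: "r \<odot>\<^bsub>alexander_module D\<^esub> gamma D v = gamma D (\<lambda>a. r * v a)"
proof -
  have "r \<odot>\<^bsub>alexander_module D\<^esub> gamma D v = (\<Union>x\<in>gamma D v. gamma D (\<lambda>a. r * x a))"
    unfolding alexander_module_def quotient_module_def
    by (simp add: free_module_simps gamma_def)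
  also have "\<dots> = (\<Union>x\<in>gamma D v. gamma D (\<lambda>a. r * v a))"
    by (rule SUP_cong[OF HOL.refl gamma_smult_cong]) (erule mem_gamma_iff[THEN iffD1])
  also have "\<dots> = gamma D (\<lambda>a. r * v a)"
    using mem_gamma_iff[of v D v] by auto
  finally show ?thesis .
qed

text \<open>The additive inverse is a definite description over the carrier, so \<open>w\<close> has
  to be supported on the arcs; sums and multiples of cosets are computed without this.\<close>

lemma gamma_minus:
  assumes "w \<in> vectors D"
  shows "gamma D v \<ominus>\<^bsub>alexander_module D\<^esub> gamma D w = gamma D (\<lambda>a. v a - w a)"
proof -
  have "\<ominus>\<^bsub>alexander_module D\<^esub> gamma D w = gamma D (\<lambda>a. - w a)"
    unfolding a_inv_def m_inv_def
  proof (rule the_equality, simp_all add: carrier_alexander_module gamma_add zero_alexander_module)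
    show "gamma D (\<lambda>a. - w a) \<in> gamma D ` vectors D"
      using assms by (auto simp: vectors_iff)
  next
    fix y assume y: "y \<in> gamma D ` vectors D \<and> gamma D w \<oplus>\<^bsub>alexander_module D\<^esub> y = gamma D (\<lambda>a. 0)
      \<and> y \<oplus>\<^bsub>alexander_module D\<^esub> gamma D w = gamma D (\<lambda>a. 0)"
    then obtain u where u: "y = gamma D u" by blast
    from y have "gamma D (\<lambda>a. w a + u a) = gamma D (\<lambda>a. 0)" by (simp add: u gamma_add)
    then show "y = gamma D (\<lambda>a. - w a)" by (simp add: u gamma_eq_iff add.commute)
  qed
  then show ?thesis by (simp add: a_minus_def gamma_add)
qed

lemma alexander_quandle_simps:
  "carrier (total_alexander_quandle D)
     = {x \<in> carrier (alexander_module D). phi D x + 1 \<in> Units Lambda}"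
  "x \<triangleright>\<^bsub>total_alexander_quandle D\<^esub> y = ((phi D y + 1) \<odot>\<^bsub>alexander_module D\<^esub> x)
     \<ominus>\<^bsub>alexander_module D\<^esub> (phi D x \<odot>\<^bsub>alexander_module D\<^esub> y)"
  "x \<triangleleft>\<^bsub>total_alexander_quandle D\<^esub> y = (inv\<^bsub>Lambda\<^esub> (phi D y + 1)) \<odot>\<^bsub>alexander_module D\<^esub>
     (x \<oplus>\<^bsub>alexander_module D\<^esub> (phi D x \<odot>\<^bsub>alexander_module D\<^esub> y))"
  by (simp_all add: total_alexander_quandle_def Let_def)

lemma aug_basis:
  assumes "finite (arcs D)" and "a \<in> arcs D"
  shows "aug D (\<lambda>b. of_bool (b = a)) = tvar (kappa D a) - 1"
  using assms unfolding aug_def by (simp add: of_bool_def if_distrib[where f="\<lambda>x. x * _"] cong: if_cong)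

context tame_diagram
begin

lemma relator_in_rho_image:
  assumes "c \<in> crossings D"
  shows "relator D c \<in> rho_image D"
proof -
  have "relator D c = rho D (\<lambda>d. of_bool (d = c))"
    using assms finite_crossings unfolding rho_def
    by (simp add: fun_eq_iff of_bool_def if_distrib[where f="\<lambda>x. x * _"] cong: if_cong)
  then show ?thesis unfolding rho_image_eq by blast
qed

text \<open>The three terms cancel because the two underpassing arcs carry the same variable. Hence
  \<open>aug\<close> is constant on cosets and \<open>phi\<close> is well defined.\<close>

lemma aug_relator:
  assumes "c \<in> crossings D"
  shows "aug D (relator D c) = 0"
proof -
  define x y z where "x = over_arc D c" and "y = right_arc D c" and "z = left_arc D c"
  have in_arcs: "x \<in> arcs D" "y \<in> arcs D" "z \<in> arcs D"
    using assms over_arc_in_arcs right_arc_in_arcs left_arc_in_arcs by (auto simp: x_def y_def z_def)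
  have ring: "(1 - t) * (s - 1) + s * (t - 1) - (t - 1) = 0" for s t :: "'m laurent"
    by (simp add: algebra_simps)
  have "aug D (relator D c) = (1 - tvar (kappa D y)) * (tvar (kappa D x) - 1)
     + tvar (kappa D x) * (tvar (kappa D y) - 1) - (tvar (kappa D z) - 1)"
    unfolding relator_def Let_def x_def[symmetric] y_def[symmetric] z_def[symmetric]
      aug_diff aug_add aug_smult
    by (simp only: aug_basis[OF finite_arcs] in_arcs)
  also have "kappa D z = kappa D y"
    using kappa_left_arc[OF assms] by (simp add: y_def z_def)
  finally show ?thesis by (simp only: ring)
qed

lemma aug_rho_image: "n \<in> rho_image D \<Longrightarrow> aug D n = 0"
  unfolding rho_image_eq rho_def by (auto simp: aug_sum aug_smult aug_relator)

lemma phi_gamma: "phi D (gamma D v) = aug D v"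
proof -
  have "aug D x = aug D v" if "x \<in> gamma D v" for x
    using that unfolding gamma_alt by (auto simp: aug_add aug_rho_image)
  moreover have "v \<in> gamma D v" by (simp add: mem_gamma_iff)
  ultimately have "aug D ` gamma D v = {aug D v}" by blast
  then show ?thesis unfolding phi_def aug_def by simp
qed

lemma gamma_in_carrier: "v \<in> vectors D \<Longrightarrow> gamma D v \<in> carrier (alexander_module D)"
  by (simp add: carrier_alexander_module)

lemma basis_in_vectors: "a \<in> arcs D \<Longrightarrow> (\<lambda>b. of_bool (b = a)) \<in> vectors D"
  by (auto simp: vectors_iff)

lemma gamma_arc_in_carrier: "a \<in> arcs D \<Longrightarrow> gamma_arc D a \<in> carrier (alexander_module D)"
  unfolding gamma_arc_def by (intro gamma_in_carrier basis_in_vectors)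

lemma phi_gamma_arc: "a \<in> arcs D \<Longrightarrow> phi D (gamma_arc D a) = tvar (kappa D a) - 1"
  unfolding gamma_arc_def by (simp add: phi_gamma aug_basis finite_arcs)

lemma alexander_module_cases:
  assumes "x \<in> carrier (alexander_module D)"
  obtains v where "v \<in> vectors D" and "x = gamma D v"
  using assms by (auto simp: carrier_alexander_module)

lemma alexander_module_closed:
  assumes "x \<in> carrier (alexander_module D)"
  shows "y \<in> carrier (alexander_module D) \<Longrightarrow> x \<oplus>\<^bsub>alexander_module D\<^esub> y \<in> carrier (alexander_module D)"
    and "r \<odot>\<^bsub>alexander_module D\<^esub> x \<in> carrier (alexander_module D)"
  using assms
  by (auto elim!: alexander_module_cases intro!: gamma_in_carrier
      simp: gamma_add gamma_smult vectors_iff)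

text \<open>Makes additive and semilinear maps commute with subtraction, which is otherwise a
  definite description in the target module.\<close>

lemma alexander_module_minus_eq:
  assumes "y \<in> carrier (alexander_module D)" and "x \<in> carrier (alexander_module D)"
  shows "x \<ominus>\<^bsub>alexander_module D\<^esub> y
     = x \<oplus>\<^bsub>alexander_module D\<^esub> ((- 1) \<odot>\<^bsub>alexander_module D\<^esub> y)"
  using assms by (auto elim!: alexander_module_cases simp: gamma_minus gamma_add gamma_smult)

lemma alexander_module_induct [consumes 1, case_names arc add smult]:
  assumes "x \<in> carrier (alexander_module D)"
    and arc: "\<And>a. a \<in> arcs D \<Longrightarrow> P (gamma_arc D a)"
    and add: "\<And>x y. \<lbrakk>x \<in> carrier (alexander_module D); y \<in> carrier (alexander_module D); P x; P y\<rbrakk>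
      \<Longrightarrow> P (x \<oplus>\<^bsub>alexander_module D\<^esub> y)"
    and smult: "\<And>r x. \<lbrakk>x \<in> carrier (alexander_module D); P x\<rbrakk>
      \<Longrightarrow> P (r \<odot>\<^bsub>alexander_module D\<^esub> x)"
  shows "P x"
proof -
  obtain v where v: "v \<in> vectors D" "x = gamma D v"
    using assms(1) by (rule alexander_module_cases)
  \<comment> \<open>Truncations of \<open>v\<close>, to be built up one arc at a time.\<close>
  define w where "w S = (\<lambda>b. if b \<in> S then v b else 0)" for S
  have "P (gamma D (w S))" if "finite S" "S \<subseteq> arcs D" for S
    using that
  proof (induction S)
    case empty
    \<comment> \<open>The induction has no case for zero. Some arc exists because the index type is
      inhabited, and \<open>0\<close> times its class is zero.\<close>
    obtain a where a: "a \<in> arcs D" using kappa_surj by blast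
    have "0 \<odot>\<^bsub>alexander_module D\<^esub> gamma_arc D a = gamma D (w {})"
      by (simp add: w_def gamma_arc_def gamma_smult)
    then show ?case using smult[OF gamma_arc_in_carrier[OF a] arc[OF a], of 0] by simp
  next
    case (insert a S)
    then have a: "a \<in> arcs D" by simp
    have S: "gamma D (w S) \<in> carrier (alexander_module D)"
      using insert by (intro gamma_in_carrier) (auto simp: w_def vectors_iff)
    have "(\<lambda>b. w S b + v a * of_bool (b = a)) = w (insert a S)"
      using insert by (auto simp: w_def)
    then have "gamma D (w S) \<oplus>\<^bsub>alexander_module D\<^esub> (v a \<odot>\<^bsub>alexander_module D\<^esub> gamma_arc D a)
      = gamma D (w (insert a S))"
      unfolding gamma_arc_def gamma_smult gamma_add by simp
    then show ?case
      using add[OF S alexander_module_closed(2) _ smult, OF gamma_arc_in_carrier[OF a]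
          _ gamma_arc_in_carrier[OF a] arc[OF a], of "v a"] insert by simp
  qed
  from this[OF finite_arcs] have "P (gamma D (w (arcs D)))" by simp
  moreover have "w (arcs D) = v" using v(1) by (auto simp: w_def vectors_iff)
  ultimately show ?thesis using v(2) by simp
qed

end

section \<open>The Alexander quandles\<close>

text \<open>(Q1) and (Q3) in one coordinate, with \<open>p\<close>, \<open>q\<close>,
  \<open>r\<close> the values of \<open>phi\<close> at the elements whose coordinates are
  \<open>x\<close>, \<open>y\<close>, \<open>z\<close>. The factor
  \<open>(r + 1) * q - q * r\<close> is \<open>phi\<close> of the product of the second and third
  element, left unsimplified.\<close>

lemma alexander_op_identities:
  fixes p q r x y z :: "'r::comm_ring_1"
  shows "(p + 1) * x - p * x = x"
    and "(r + 1) * ((q + 1) * x - p * y) - p * z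
      = ((r + 1) * q - q * r + 1) * ((r + 1) * x - p * z) - p * ((r + 1) * y - q * z)"
  by (simp_all add: algebra_simps)

context tame_diagram
begin

abbreviation "M \<equiv> alexander_module D"
abbreviation "U \<equiv> total_alexander_quandle D"
abbreviation "QA \<equiv> fundamental_alexander_quandle D"

lemma gamma_in_U: "v \<in> vectors D \<Longrightarrow> gamma D v \<in> carrier U \<longleftrightarrow> aug D v + 1 \<in> Units Lambda"
  by (simp add: alexander_quandle_simps gamma_in_carrier phi_gamma)

lemma U_cases:
  assumes "x \<in> carrier U"
  obtains v where "v \<in> vectors D" and "x = gamma D v" and "aug D v + 1 \<in> Units Lambda"
  using assms by (auto simp: alexander_quandle_simps phi_gamma elim!: alexander_module_cases)

lemma qop_gamma:
  assumes "w \<in> vectors D"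
  shows "gamma D v \<triangleright>\<^bsub>U\<^esub> gamma D w = gamma D (\<lambda>a. (aug D w + 1) * v a - aug D v * w a)"
  using assms by (simp add: alexander_quandle_simps phi_gamma gamma_smult gamma_minus vectors_iff)

lemma qinv_gamma:
  "gamma D v \<triangleleft>\<^bsub>U\<^esub> gamma D w
    = gamma D (\<lambda>a. inv\<^bsub>Lambda\<^esub> (aug D w + 1) * (v a + aug D v * w a))"
  by (simp add: alexander_quandle_simps phi_gamma gamma_smult gamma_add)

lemma aug_qop: "aug D (\<lambda>a. (aug D w + 1) * v a - aug D v * w a) = aug D v"
  unfolding aug_diff aug_smult by (simp add: algebra_simps)

lemma aug_qinv:
  assumes "aug D w + 1 \<in> Units Lambda"
  shows "aug D (\<lambda>a. inv\<^bsub>Lambda\<^esub> (aug D w + 1) * (v a + aug D v * w a)) = aug D v"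
proof -
  have "aug D (\<lambda>a. inv\<^bsub>Lambda\<^esub> (aug D w + 1) * (v a + aug D v * w a))
      = (inv\<^bsub>Lambda\<^esub> (aug D w + 1) * (aug D w + 1)) * aug D v"
    unfolding aug_smult aug_add by (simp add: algebra_simps)
  then show ?thesis by (simp only: inv_Lambda[OF assms] mult_1_left)
qed

lemma U_closed:
  assumes "x \<in> carrier U" and "y \<in> carrier U"
  shows "x \<triangleright>\<^bsub>U\<^esub> y \<in> carrier U" and "x \<triangleleft>\<^bsub>U\<^esub> y \<in> carrier U"
    and "phi D (x \<triangleright>\<^bsub>U\<^esub> y) = phi D x" and "phi D (x \<triangleleft>\<^bsub>U\<^esub> y) = phi D x"
proof -
  obtain v where v: "v \<in> vectors D" "x = gamma D v" "aug D v + 1 \<in> Units Lambda"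
    using assms(1) by (rule U_cases)
  obtain w where w: "w \<in> vectors D" "y = gamma D w" "aug D w + 1 \<in> Units Lambda"
    using assms(2) by (rule U_cases)
  show "phi D (x \<triangleright>\<^bsub>U\<^esub> y) = phi D x"
    unfolding v w qop_gamma[OF w(1)] phi_gamma by (rule aug_qop)
  show "phi D (x \<triangleleft>\<^bsub>U\<^esub> y) = phi D x"
    unfolding v w qinv_gamma phi_gamma by (rule aug_qinv[OF w(3)])
  have "(\<lambda>a. (aug D w + 1) * v a - aug D v * w a) \<in> vectors D"
    "(\<lambda>a. inv\<^bsub>Lambda\<^esub> (aug D w + 1) * (v a + aug D v * w a)) \<in> vectors D"
    using v(1) w(1) by (simp_all add: vectors_iff)
  then show "x \<triangleright>\<^bsub>U\<^esub> y \<in> carrier U" "x \<triangleleft>\<^bsub>U\<^esub> y \<in> carrier U"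
    unfolding v(2) w(2) qop_gamma[OF w(1)] qinv_gamma
    by (simp_all only: gamma_in_U aug_qop aug_qinv[OF w(3)] v(3))
qed

lemma quandle_U: "quandle U"
proof
  show "x \<triangleright>\<^bsub>U\<^esub> y \<in> carrier U" "x \<triangleleft>\<^bsub>U\<^esub> y \<in> carrier U"
    if "x \<in> carrier U" "y \<in> carrier U" for x y
    using that by (rule U_closed)+
next
  fix x assume "x \<in> carrier U"
  then obtain v where v: "v \<in> vectors D" "x = gamma D v" by (rule U_cases)
  show "x \<triangleright>\<^bsub>U\<^esub> x = x"
    unfolding v(2) qop_gamma[OF v(1)] alexander_op_identities(1) ..
next
  fix x y assume "x \<in> carrier U" "y \<in> carrier U"
  obtain v where v: "v \<in> vectors D" "x = gamma D v"
    using \<open>x \<in> carrier U\<close> by (rule U_cases)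
  obtain w where w: "w \<in> vectors D" "y = gamma D w" "aug D w + 1 \<in> Units Lambda"
    using \<open>y \<in> carrier U\<close> by (rule U_cases)
  have u: "inv\<^bsub>Lambda\<^esub> (aug D w + 1) * (aug D w + 1) = 1"
    by (rule inv_Lambda[OF w(3)])
  have *: "inv\<^bsub>Lambda\<^esub> (aug D w + 1) * ((aug D w + 1) * p) = p"
    "(aug D w + 1) * (inv\<^bsub>Lambda\<^esub> (aug D w + 1) * p) = p" for p
    using u mult.assoc[of "inv\<^bsub>Lambda\<^esub> (aug D w + 1)" "aug D w + 1" p]
      mult.left_commute[of "aug D w + 1" "inv\<^bsub>Lambda\<^esub> (aug D w + 1)" p]
    by (simp_all only: mult_1_left)
  show "(x \<triangleright>\<^bsub>U\<^esub> y) \<triangleleft>\<^bsub>U\<^esub> y = x"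
    unfolding v(2) w(2) qop_gamma[OF w(1)] qinv_gamma aug_qop diff_add_cancel * ..
  show "(x \<triangleleft>\<^bsub>U\<^esub> y) \<triangleright>\<^bsub>U\<^esub> y = x"
    unfolding v(2) w(2) qop_gamma[OF w(1)] qinv_gamma aug_qinv[OF w(3)] * add_diff_cancel_right' ..
next
  fix x y z assume "x \<in> carrier U" "y \<in> carrier U" "z \<in> carrier U"
  obtain v where v: "v \<in> vectors D" "x = gamma D v"
    using \<open>x \<in> carrier U\<close> by (rule U_cases)
  obtain w where w: "w \<in> vectors D" "y = gamma D w"
    using \<open>y \<in> carrier U\<close> by (rule U_cases)
  obtain t where t: "t \<in> vectors D" "z = gamma D t"
    using \<open>z \<in> carrier U\<close> by (rule U_cases)
  have s: "(\<lambda>a. (aug D t + 1) * w a - aug D w * t a) \<in> vectors D"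
    using w t by (simp add: vectors_iff)
  have "((aug D t + 1) * aug D w - aug D w * aug D t + 1) = aug D w + 1"
    by (simp add: algebra_simps)
  then show "(x \<triangleright>\<^bsub>U\<^esub> y) \<triangleright>\<^bsub>U\<^esub> z = (x \<triangleright>\<^bsub>U\<^esub> z) \<triangleright>\<^bsub>U\<^esub> (y \<triangleright>\<^bsub>U\<^esub> z)"
    unfolding v(2) w(2) t(2) qop_gamma[OF w(1)] qop_gamma[OF t(1)] qop_gamma[OF s] aug_qop
    using alexander_op_identities(2)[of "aug D t" "aug D w" _ "aug D v"] by simp
qed

lemma subquandle_UI:
  assumes "H \<subseteq> carrier U"
    and "\<And>x y. \<lbrakk>x \<in> H; y \<in> H\<rbrakk> \<Longrightarrow> x \<triangleright>\<^bsub>U\<^esub> y \<in> H"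
    and "\<And>x y. \<lbrakk>x \<in> H; y \<in> H\<rbrakk> \<Longrightarrow> x \<triangleleft>\<^bsub>U\<^esub> y \<in> H"
  shows "subquandle H U"
proof -
  interpret quandle U by (rule quandle_U)
  show ?thesis
    unfolding subquandle_def
  proof (intro conjI assms(1))
    show "quandle (U\<lparr>carrier := H\<rparr>)"
      by (unfold_locales, simp_all add: assms(2,3) Q1 Q2 Q2' subsetD[OF assms(1)])
        (rule Q3; erule subsetD[OF assms(1)])
  qed
qed

lemma carrier_QA: "carrier QA = \<Inter>{H. subquandle H U \<and> gamma_arc D ` arcs D \<subseteq> H}"
  and qop_QA: "x \<triangleright>\<^bsub>QA\<^esub> y = x \<triangleright>\<^bsub>U\<^esub> y"
  and qinv_QA: "x \<triangleleft>\<^bsub>QA\<^esub> y = x \<triangleleft>\<^bsub>U\<^esub> y"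
  by (simp_all add: fundamental_alexander_quandle_def generated_subquandle_def)

lemma gamma_arc_in_U: "a \<in> arcs D \<Longrightarrow> gamma_arc D a \<in> carrier U"
  by (simp add: alexander_quandle_simps gamma_arc_in_carrier phi_gamma_arc tvar_in_Units)

text \<open>\<open>carrier U\<close> belongs to the family that is intersected, so the intersection
  stays inside it.\<close>

lemma QA_subset_U: "carrier QA \<subseteq> carrier U"
  unfolding carrier_QA
  using subquandle_UI[of "carrier U"] U_closed gamma_arc_in_U by blast

lemma gamma_arc_in_QA: "a \<in> arcs D \<Longrightarrow> gamma_arc D a \<in> carrier QA"
  unfolding carrier_QA by blast

lemma QA_closed:
  assumes "x \<in> carrier QA" and "y \<in> carrier QA"
  shows "x \<triangleright>\<^bsub>U\<^esub> y \<in> carrier QA" and "x \<triangleleft>\<^bsub>U\<^esub> y \<in> carrier QA"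
proof -
  have "x \<triangleright>\<^bsub>U\<^esub> y \<in> H \<and> x \<triangleleft>\<^bsub>U\<^esub> y \<in> H" if "subquandle H U" "gamma_arc D ` arcs D \<subseteq> H" for H
  proof -
    interpret quandle "U\<lparr>carrier := H\<rparr>"
      using that(1) by (simp add: subquandle_def)
    have "x \<in> H" "y \<in> H" using that assms unfolding carrier_QA by blast+
    then show ?thesis using qop_closed[of x y] qinv_closed[of x y] by simp
  qed
  then show "x \<triangleright>\<^bsub>U\<^esub> y \<in> carrier QA" "x \<triangleleft>\<^bsub>U\<^esub> y \<in> carrier QA"
    unfolding carrier_QA by blast+
qed

lemma QA_induct [consumes 1, case_names arc qop qinv]:
  assumes "x \<in> carrier QA"
    and arc: "\<And>a. a \<in> arcs D \<Longrightarrow> P (gamma_arc D a)"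
    and qop: "\<And>x y. \<lbrakk>x \<in> carrier QA; y \<in> carrier QA; P x; P y\<rbrakk> \<Longrightarrow> P (x \<triangleright>\<^bsub>U\<^esub> y)"
    and qinv: "\<And>x y. \<lbrakk>x \<in> carrier QA; y \<in> carrier QA; P x; P y\<rbrakk> \<Longrightarrow> P (x \<triangleleft>\<^bsub>U\<^esub> y)"
  shows "P x"
proof -
  have "subquandle {x \<in> carrier QA. P x} U"
    using QA_subset_U by (intro subquandle_UI) (auto intro: QA_closed qop qinv)
  moreover have "gamma_arc D ` arcs D \<subseteq> {x \<in> carrier QA. P x}"
    using gamma_arc_in_QA arc by blast
  ultimately show ?thesis using assms(1) unfolding carrier_QA by blast
qed

text \<open>On \<open>U\<close> other units occur, such as products of variables. On
  \<open>QA\<close> the value is inherited from a generating arc, since both operations keep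
  \<open>phi\<close> of their left argument.\<close>

lemma QA_component: "x \<in> carrier QA \<Longrightarrow> \<exists>i. phi D x + 1 = tvar i"
proof (induction rule: QA_induct)
  case (arc a)
  then show ?case by (auto simp: phi_gamma_arc)
next
  case (qop x y)
  then show ?case using U_closed(3)[of x y] subsetD[OF QA_subset_U] by metis
next
  case (qinv x y)
  then show ?case using U_closed(4)[of x y] subsetD[OF QA_subset_U] by metis
qed

text \<open>With \<open>phi + 1 = tvar (kappa D a1)\<close> at the overpass and
  \<open>- phi = 1 - tvar (kappa D a2)\<close> at the right arc, the relator is the difference of
  representatives of the two sides.\<close>

lemma gamma_arc_crossing:
  assumes "c \<in> crossings D"
  shows "gamma_arc D (right_arc D c) \<triangleright>\<^bsub>U\<^esub> gamma_arc D (over_arc D c) = gamma_arc D (left_arc D c)"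
proof -
  define x y z where "x = over_arc D c" and "y = right_arc D c" and "z = left_arc D c"
  have in_arcs: "x \<in> arcs D" "y \<in> arcs D"
    using assms over_arc_in_arcs right_arc_in_arcs by (auto simp: x_def y_def)
  define r where "r = relator D c"
  have "r = (\<lambda>a. (tvar (kappa D x) - 1 + 1) * of_bool (a = y)
      - (tvar (kappa D y) - 1) * of_bool (a = x) - of_bool (a = z))"
    unfolding r_def relator_def Let_def x_def[symmetric] y_def[symmetric] z_def[symmetric]
    by (simp add: algebra_simps)
  moreover have "r \<in> rho_image D"
    unfolding r_def by (rule relator_in_rho_image[OF assms])
  ultimately show ?thesis
    unfolding gamma_arc_def x_def[symmetric] y_def[symmetric] z_def[symmetric]
      qop_gamma[OF basis_in_vectors[OF in_arcs(1)]] aug_basis[OF finite_arcs in_arcs(1)]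
      aug_basis[OF finite_arcs in_arcs(2)] gamma_eq_iff by simp
qed

end

section \<open>Extension of quandle morphisms to the module sequences\<close>

text \<open>Morphisms of link module sequences, semilinear over the relabelling of the variables.\<close>

definition sequence_hom where
  "sequence_hom \<sigma> D D' F \<longleftrightarrow>
     (\<forall>x\<in>carrier (alexander_module D). F x \<in> carrier (alexander_module D')) \<and>
     (\<forall>x\<in>carrier (alexander_module D). \<forall>y\<in>carrier (alexander_module D).
        F (x \<oplus>\<^bsub>alexander_module D\<^esub> y) = F x \<oplus>\<^bsub>alexander_module D'\<^esub> F y) \<and>
     (\<forall>r. \<forall>x\<in>carrier (alexander_module D).
        F (r \<odot>\<^bsub>alexander_module D\<^esub> x) = relabel \<sigma> r \<odot>\<^bsub>alexander_module D'\<^esub> F x) \<and>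
     (\<forall>x\<in>carrier (alexander_module D). phi D' (F x) = relabel \<sigma> (phi D x))"

text \<open>The composition law of \<open>relabel\<close> is itself a hypothesis, which avoids any
  condition on the maps of indices; it is applied to mutually inverse relabellings, with
  \<open>id\<close> as the composite.\<close>

lemma sequence_hom_comp:
  assumes "sequence_hom \<sigma> D D' F" and "sequence_hom \<tau> D' D'' G"
    and "\<And>r. relabel \<tau> (relabel \<sigma> r) = relabel \<rho> r"
  shows "sequence_hom \<rho> D D'' (G \<circ> F)"
  using assms by (simp add: sequence_hom_def)

locale diagram_pair = D: tame_diagram D + D': tame_diagram D'
  for D :: "'m diagram" and D' :: "'n diagram" +
  fixes \<sigma> :: "'m \<Rightarrow> 'n"
  assumes bij_\<sigma>: "bij \<sigma>"
begin

lemma sequence_hom_quandle: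
  assumes F: "sequence_hom \<sigma> D D' F" and x: "x \<in> carrier D.U" and y: "y \<in> carrier D.U"
  shows "F x \<in> carrier D'.U"
    and "F (x \<triangleright>\<^bsub>D.U\<^esub> y) = F x \<triangleright>\<^bsub>D'.U\<^esub> F y"
    and "F (x \<triangleleft>\<^bsub>D.U\<^esub> y) = F x \<triangleleft>\<^bsub>D'.U\<^esub> F y"
proof -
  have M: "x \<in> carrier D.M" "y \<in> carrier D.M" "F x \<in> carrier D'.M" "F y \<in> carrier D'.M"
    and add: "\<And>x y. \<lbrakk>x \<in> carrier D.M; y \<in> carrier D.M\<rbrakk>
      \<Longrightarrow> F (x \<oplus>\<^bsub>D.M\<^esub> y) = F x \<oplus>\<^bsub>D'.M\<^esub> F y"
    and smult: "\<And>r x. x \<in> carrier D.M \<Longrightarrow> F (r \<odot>\<^bsub>D.M\<^esub> x) = relabel \<sigma> r \<odot>\<^bsub>D'.M\<^esub> F x"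
    and phi: "phi D' (F x) = relabel \<sigma> (phi D x)" "phi D' (F y) = relabel \<sigma> (phi D y)"
    using F x y unfolding sequence_hom_def alexander_quandle_simps by blast+
  note rel = relabel_simps[OF bij_\<sigma>]
  have phi1: "phi D' (F z) + 1 = relabel \<sigma> (phi D z + 1)" if "z \<in> {x, y}" for z
    using that by (auto simp: phi rel)
  have ux: "phi D x + 1 \<in> Units Lambda" and uy: "phi D y + 1 \<in> Units Lambda"
    using x y by (simp_all add: alexander_quandle_simps)
  show "F x \<in> carrier D'.U"
    unfolding alexander_quandle_simps using M(3) relabel_Units(1)[OF bij_\<sigma> ux]
    by (simp add: phi1)
  show "F (x \<triangleright>\<^bsub>D.U\<^esub> y) = F x \<triangleright>\<^bsub>D'.U\<^esub> F y"
    unfolding alexander_quandle_simps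
    by (simp add: D.alexander_module_minus_eq D'.alexander_module_minus_eq
        D.alexander_module_closed D'.alexander_module_closed M add smult phi rel)
  show "F (x \<triangleleft>\<^bsub>D.U\<^esub> y) = F x \<triangleleft>\<^bsub>D'.U\<^esub> F y"
    unfolding alexander_quandle_simps phi1[of y, simplified] relabel_Units(2)[OF bij_\<sigma> uy]
    by (simp add: D.alexander_module_closed M add smult phi)
qed

lemma sequence_hom_extension:
  assumes h: "\<And>a. a \<in> arcs D \<Longrightarrow> h a \<in> carrier D'.U"
    and phi_h: "\<And>a. a \<in> arcs D \<Longrightarrow> phi D' (h a) + 1 = tvar (\<sigma> (kappa D a))"
    and cross: "\<And>c. c \<in> crossings D \<Longrightarrow>
      h (right_arc D c) \<triangleright>\<^bsub>D'.U\<^esub> h (over_arc D c) = h (left_arc D c)"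
  shows "\<exists>F. sequence_hom \<sigma> D D' F \<and> (\<forall>a\<in>arcs D. F (gamma_arc D a) = h a)"
proof -
  note rel = relabel_simps[OF bij_\<sigma>]
  have "\<exists>v. v \<in> vectors D' \<and> h a = gamma D' v" if "a \<in> arcs D" for a
    using h[OF that] by (rule D'.U_cases) blast
  then obtain g where g: "\<And>a. a \<in> arcs D \<Longrightarrow> g a \<in> vectors D'"
    "\<And>a. a \<in> arcs D \<Longrightarrow> h a = gamma D' (g a)" by metis
  have aug_g: "aug D' (g a) = tvar (\<sigma> (kappa D a)) - 1" if "a \<in> arcs D" for a
    using phi_h[OF that] by (simp add: g(2)[OF that] D'.phi_gamma eq_diff_eq)
  \<comment> \<open>The semilinear lift to free modules. The representatives \<open>g a\<close> are
    arbitrary, so only its values modulo \<open>rho_image D'\<close> are meaningful.\<close>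
  define T where "T v = (\<lambda>b. \<Sum>a\<in>arcs D. relabel \<sigma> (v a) * g a b)" for v
  have T_vec: "T v \<in> vectors D'" for v
    using g(1) by (simp add: T_def vectors_iff)
  have T_add: "T (\<lambda>a. v a + w a) = (\<lambda>b. T v b + T w b)" for v w
    by (simp add: T_def rel distrib_right sum.distrib)
  have T_diff: "T (\<lambda>a. v a - w a) = (\<lambda>b. T v b - T w b)" for v w
    by (simp add: T_def rel left_diff_distrib sum_subtractf)
  have T_smult: "T (\<lambda>a. r * v a) = (\<lambda>b. relabel \<sigma> r * T v b)" for r v
    by (simp add: T_def rel sum_distrib_left mult.assoc)
  have T_sum: "T (\<lambda>a. \<Sum>i\<in>I. v i a) = (\<lambda>b. \<Sum>i\<in>I. T (v i) b)" for v and I :: "(real^2) set"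
    by (simp add: T_def relabel_sum[OF bij_\<sigma>] sum_distrib_right) (intro ext sum.swap)
  have T_basis: "T (\<lambda>b. of_bool (b = a)) = g a" if "a \<in> arcs D" for a
    using that D.finite_arcs
    by (simp add: T_def fun_eq_iff of_bool_def if_distrib[where f="relabel \<sigma>"] rel
        if_distrib[where f="\<lambda>x. x * _"] cong: if_cong)
  have T_relator: "T (relator D c) \<in> rho_image D'" if c: "c \<in> crossings D" for c
  proof -
    define x y z where "x = over_arc D c" and "y = right_arc D c" and "z = left_arc D c"
    have A: "x \<in> arcs D" "y \<in> arcs D" "z \<in> arcs D"
      using c D.over_arc_in_arcs D.right_arc_in_arcs D.left_arc_in_arcs
      by (auto simp: x_def y_def z_def)
    have "gamma D' (g y) \<triangleright>\<^bsub>D'.U\<^esub> gamma D' (g x) = gamma D' (g z)"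
      using cross[OF c] by (simp add: g(2) A flip: x_def y_def z_def)
    then have "(\<lambda>a. tvar (\<sigma> (kappa D x)) * g y a - (tvar (\<sigma> (kappa D y)) - 1) * g x a - g z a)
      \<in> rho_image D'"
      by (simp add: D'.qop_gamma[OF g(1)[OF A(1)]] gamma_eq_iff aug_g A)
    moreover have "T (relator D c) = (\<lambda>a. (1 - tvar (\<sigma> (kappa D y))) * g x a
        + tvar (\<sigma> (kappa D x)) * g y a - g z a)"
      unfolding relator_def Let_def x_def[symmetric] y_def[symmetric] z_def[symmetric]
        T_diff T_add T_smult T_basis[OF A(1)] T_basis[OF A(2)] T_basis[OF A(3)] rel ..
    ultimately show ?thesis by (simp add: algebra_simps)
  qed
  have T_rho: "T n \<in> rho_image D'" if "n \<in> rho_image D" for n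
    using that T_relator
    by (auto simp: rho_image_eq[of D] rho_def T_sum T_smult intro!: rho_image_sum rho_image_smult)
  \<comment> \<open>Any member of the coset may be used: \<open>T_rho\<close> makes the choice
    irrelevant.\<close>
  define F where "F X = gamma D' (T (SOME v. v \<in> X))" for X
  have F: "F (gamma D v) = gamma D' (T v)" for v
  proof -
    have "v \<in> gamma D v" by (simp add: mem_gamma_iff)
    then have "(SOME w. w \<in> gamma D v) \<in> gamma D v"
      by (rule someI[where P="\<lambda>w. w \<in> gamma D v"])
    then have "(\<lambda>a. (SOME w. w \<in> gamma D v) a - v a) \<in> rho_image D"
      unfolding mem_gamma_iff gamma_eq_iff .
    from T_rho[OF this] show ?thesis unfolding F_def gamma_eq_iff T_diff .
  qed
  have aug_T: "aug D' (T v) = relabel \<sigma> (aug D v)" for v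
  proof -
    have "aug D' (T v) = (\<Sum>a\<in>arcs D. relabel \<sigma> (v a) * aug D' (g a))"
      unfolding T_def aug_sum aug_smult ..
    also have "\<dots> = (\<Sum>a\<in>arcs D. relabel \<sigma> (v a * (tvar (kappa D a) - 1)))"
      by (intro sum.cong HOL.refl) (simp add: aug_g rel)
    finally show ?thesis by (simp only: aug_def[of D] relabel_sum[OF bij_\<sigma>])
  qed
  have "sequence_hom \<sigma> D D' F"
    unfolding sequence_hom_def carrier_alexander_module
    by (auto simp: F gamma_add gamma_smult T_add T_smult T_vec D.phi_gamma D'.phi_gamma aug_T)
  moreover have "F (gamma_arc D a) = h a" if "a \<in> arcs D" for a
    unfolding gamma_arc_def[of D] F T_basis[OF that] g(2)[OF that] ..
  ultimately show ?thesis by blast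
qed

text \<open>The two relabellings cancel, so the composite is linear, and the arcs generate the
  module.\<close>

lemma sequence_hom_left_inverse:
  assumes F: "sequence_hom \<sigma> D D' F" and G: "sequence_hom (inv_into UNIV \<sigma>) D' D G"
    and id: "\<And>a. a \<in> arcs D \<Longrightarrow> G (F (gamma_arc D a)) = gamma_arc D a"
    and "x \<in> carrier D.M"
  shows "G (F x) = x"
  using assms(4)
proof (induction x rule: D.alexander_module_induct)
  case (add x y)
  then show ?case using F G by (simp add: sequence_hom_def)
next
  case (smult r x)
  then show ?case using F G by (simp add: sequence_hom_def relabel_inverse[OF bij_\<sigma>])
qed (rule id)

lemma diagram_pair_swap: "diagram_pair D' D (inv_into UNIV \<sigma>)"
  by unfold_locales (rule bij_imp_bij_inv[OF bij_\<sigma>])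

lemma sequence_hom_bij:
  assumes F: "sequence_hom \<sigma> D D' F" and G: "sequence_hom (inv_into UNIV \<sigma>) D' D G"
    and GF: "\<And>a. a \<in> arcs D \<Longrightarrow> G (F (gamma_arc D a)) = gamma_arc D a"
    and FG: "\<And>a. a \<in> arcs D' \<Longrightarrow> F (G (gamma_arc D' a)) = gamma_arc D' a"
  shows "bij_betw F (carrier D.M) (carrier D'.M)"
proof (rule bij_betw_byWitness[where f'=G])
  interpret swap: diagram_pair D' D "inv_into UNIV \<sigma>" by (rule diagram_pair_swap)
  show "\<forall>x\<in>carrier D.M. G (F x) = x"
    using sequence_hom_left_inverse[OF F G GF] by blast
  have "inv_into UNIV (inv_into UNIV \<sigma>) = \<sigma>" by (rule inv_inv_eq[OF bij_\<sigma>])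
  then show "\<forall>x\<in>carrier D'.M. F (G x) = x"
    using swap.sequence_hom_left_inverse[OF G _ FG] F by simp
  show "F ` carrier D.M \<subseteq> carrier D'.M" "G ` carrier D'.M \<subseteq> carrier D.M"
    using F G by (auto simp: sequence_hom_def)
qed

text \<open>Surjectivity needs units to be reflected and not only preserved; relabelling along the
  inverse of \<open>\<sigma>\<close> provides this.\<close>

lemma bij_betw_U:
  assumes F: "sequence_hom \<sigma> D D' F" and bij: "bij_betw F (carrier D.M) (carrier D'.M)"
  shows "bij_betw F (carrier D.U) (carrier D'.U)"
proof (rule bij_betw_imageI)
  show "inj_on F (carrier D.U)"
    using bij by (rule inj_on_subset[OF bij_betw_imp_inj_on]) (auto simp: alexander_quandle_simps)
  have "x \<in> carrier D.U" if x: "x \<in> carrier D.M" and Fx: "F x \<in> carrier D'.U" for x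
  proof -
    have "phi D' (F x) = relabel \<sigma> (phi D x)" using F x by (simp add: sequence_hom_def)
    then have "relabel \<sigma> (phi D x + 1) \<in> Units Lambda"
      using Fx by (simp add: alexander_quandle_simps relabel_simps[OF bij_\<sigma>])
    from relabel_Units(1)[OF bij_imp_bij_inv[OF bij_\<sigma>] this] x show ?thesis
      by (simp add: alexander_quandle_simps relabel_inverse[OF bij_\<sigma>])
  qed
  moreover have "y \<in> F ` carrier D.M" if "y \<in> carrier D'.U" for y
    using that bij by (auto simp: alexander_quandle_simps bij_betw_def)
  ultimately show "F ` carrier D.U = carrier D'.U"
    using sequence_hom_quandle(1)[OF F] by blast
qed

lemma U_isomorphic:
  assumes "sequence_hom \<sigma> D D' F" and "bij_betw F (carrier D.M) (carrier D'.M)"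
  shows "D.U \<cong>\<^sub>Q D'.U"
  unfolding quandle_isomorphic_def
  using bij_betw_U[OF assms] sequence_hom_quandle[OF assms(1)] by blast

lemma QA_isomorphic:
  assumes F: "sequence_hom \<sigma> D D' F" and bij: "bij_betw F (carrier D.M) (carrier D'.M)"
    and QA: "F ` carrier D.QA = carrier D'.QA"
  shows "D.QA \<cong>\<^sub>Q D'.QA"
proof -
  have "bij_betw F (carrier D.QA) (carrier D'.QA)"
    using bij_betw_subset[OF bij_betw_U[OF assms(1,2)] D.QA_subset_U QA] .
  then show ?thesis
    unfolding quandle_isomorphic_def D.qop_QA D.qinv_QA D'.qop_QA D'.qinv_QA
    using sequence_hom_quandle[OF F] D.QA_subset_U by blast
qed

end

lemma quandle_isomorphic_trans:
  assumes "Q \<cong>\<^sub>Q Q'" and "Q' \<cong>\<^sub>Q Q''"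
  shows "Q \<cong>\<^sub>Q Q''"
proof -
  obtain f where f: "bij_betw f (carrier Q) (carrier Q')"
    "\<forall>x\<in>carrier Q. \<forall>y\<in>carrier Q. f (x \<triangleright>\<^bsub>Q\<^esub> y) = f x \<triangleright>\<^bsub>Q'\<^esub> f y \<and> f (x \<triangleleft>\<^bsub>Q\<^esub> y) = f x \<triangleleft>\<^bsub>Q'\<^esub> f y"
    using assms(1) unfolding quandle_isomorphic_def by blast
  obtain g where g: "bij_betw g (carrier Q') (carrier Q'')"
    "\<forall>x\<in>carrier Q'. \<forall>y\<in>carrier Q'. g (x \<triangleright>\<^bsub>Q'\<^esub> y) = g x \<triangleright>\<^bsub>Q''\<^esub> g y \<and> g (x \<triangleleft>\<^bsub>Q'\<^esub> y) = g x \<triangleleft>\<^bsub>Q''\<^esub> g y"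
    using assms(2) unfolding quandle_isomorphic_def by blast
  have "f x \<in> carrier Q'" if "x \<in> carrier Q" for x using that f(1) by (auto simp: bij_betw_def)
  then show ?thesis
    unfolding quandle_isomorphic_def
    by (intro exI[of _ "g \<circ> f"]) (simp add: bij_betw_trans[OF f(1) g(1)] f(2) g(2))
qed

text \<open>A common frame for \<open>Q(L)\<close> and \<open>Q\<^sub>A(L)\<close>: both are generated by the arcs and map onto \<open>Q\<^sub>A(L)\<close>.\<close>

locale marked_quandle = tame_diagram D for D :: "'m diagram" +
  fixes Q :: "('q, 'z) quandle_scheme"
    and p :: "'q \<Rightarrow> ((real^2) set \<Rightarrow> 'm laurent) set"
    and q :: "(real^2) set \<Rightarrow> 'q"
  assumes q_closed: "a \<in> arcs D \<Longrightarrow> q a \<in> carrier Q"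
    and Q_closed: "\<lbrakk>x \<in> carrier Q; y \<in> carrier Q\<rbrakk> \<Longrightarrow> x \<triangleright>\<^bsub>Q\<^esub> y \<in> carrier Q"
      "\<lbrakk>x \<in> carrier Q; y \<in> carrier Q\<rbrakk> \<Longrightarrow> x \<triangleleft>\<^bsub>Q\<^esub> y \<in> carrier Q"
    and Q_induct: "\<lbrakk>x \<in> carrier Q; \<And>a. a \<in> arcs D \<Longrightarrow> P (q a);
        \<And>x y. \<lbrakk>x \<in> carrier Q; y \<in> carrier Q; P x; P y\<rbrakk> \<Longrightarrow> P (x \<triangleright>\<^bsub>Q\<^esub> y);
        \<And>x y. \<lbrakk>x \<in> carrier Q; y \<in> carrier Q; P x; P y\<rbrakk> \<Longrightarrow> P (x \<triangleleft>\<^bsub>Q\<^esub> y)\<rbrakk> \<Longrightarrow> P x"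
    and q_crossing: "c \<in> crossings D \<Longrightarrow> q (right_arc D c) \<triangleright>\<^bsub>Q\<^esub> q (over_arc D c) = q (left_arc D c)"
    and p_q: "a \<in> arcs D \<Longrightarrow> p (q a) = gamma_arc D a"
    and p_closed: "x \<in> carrier Q \<Longrightarrow> p x \<in> carrier QA"
    and p_hom: "\<lbrakk>x \<in> carrier Q; y \<in> carrier Q\<rbrakk> \<Longrightarrow> p (x \<triangleright>\<^bsub>Q\<^esub> y) = p x \<triangleright>\<^bsub>U\<^esub> p y"
      "\<lbrakk>x \<in> carrier Q; y \<in> carrier Q\<rbrakk> \<Longrightarrow> p (x \<triangleleft>\<^bsub>Q\<^esub> y) = p x \<triangleleft>\<^bsub>U\<^esub> p y"
begin

lemma p_in_U: "x \<in> carrier Q \<Longrightarrow> p x \<in> carrier U"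
  using p_closed QA_subset_U by blast

end

locale marked_quandle_hom = D: marked_quandle D Q p q + D': marked_quandle D' Q' p' q'
  for D :: "'m diagram" and Q :: "('q, 'z) quandle_scheme" and p q
    and D' :: "'n diagram" and Q' :: "('r, 'y) quandle_scheme" and p' q' +
  fixes g :: "'q \<Rightarrow> 'r"
  assumes g_closed: "x \<in> carrier Q \<Longrightarrow> g x \<in> carrier Q'"
    and g_hom: "\<lbrakk>x \<in> carrier Q; y \<in> carrier Q\<rbrakk> \<Longrightarrow> g (x \<triangleright>\<^bsub>Q\<^esub> y) = g x \<triangleright>\<^bsub>Q'\<^esub> g y"
      "\<lbrakk>x \<in> carrier Q; y \<in> carrier Q\<rbrakk> \<Longrightarrow> g (x \<triangleleft>\<^bsub>Q\<^esub> y) = g x \<triangleleft>\<^bsub>Q'\<^esub> g y"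
begin

definition coloring :: "(real^2) set \<Rightarrow> ((real^2) set \<Rightarrow> 'n laurent) set" where
  "coloring a = p' (g (q a))"

lemma coloring_in_U: "a \<in> arcs D \<Longrightarrow> coloring a \<in> carrier D'.U"
  by (simp add: coloring_def D.q_closed g_closed D'.p_in_U)

lemma coloring_crossing:
  assumes "c \<in> crossings D"
  shows "coloring (right_arc D c) \<triangleright>\<^bsub>D'.U\<^esub> coloring (over_arc D c) = coloring (left_arc D c)"
  using D.q_closed[OF D.right_arc_in_arcs[OF assms]] D.q_closed[OF D.over_arc_in_arcs[OF assms]]
  by (simp add: coloring_def g_closed D.q_crossing[OF assms, symmetric] g_hom D'.p_hom)

lemma component_map: "\<exists>\<sigma>. \<forall>a\<in>arcs D. phi D' (coloring a) + 1 = tvar (\<sigma> (kappa D a))"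
proof -
  have "phi D' (coloring a) = phi D' (coloring b)" if "a \<in> arcs D" "b \<in> arcs D" "kappa D a = kappa D b" for a b
  proof (rule D.arcs_connected[where P="\<lambda>b. phi D' (coloring a) = phi D' (coloring b)", OF _ that HOL.refl])
    fix c assume c: "c \<in> crossings D"
    show "phi D' (coloring a) = phi D' (coloring (right_arc D c)) \<longleftrightarrow> phi D' (coloring a) = phi D' (coloring (left_arc D c))"
      unfolding coloring_crossing[OF c, symmetric]
      by (simp add: D'.U_closed(3) coloring_in_U D.right_arc_in_arcs[OF c] D.over_arc_in_arcs[OF c])
  qed
  \<comment> \<open>One arc per component supplies the value of \<open>\<sigma>\<close>; the
    preceding fact transfers it to the other arcs of the component.\<close>
  moreover have "\<forall>i. \<exists>j. \<exists>a\<in>arcs D. kappa D a = i \<and> phi D' (coloring a) + 1 = tvar j"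
    using D.kappa_surj D'.QA_component[OF D'.p_closed[OF g_closed[OF D.q_closed]]]
    unfolding coloring_def by metis
  then obtain \<sigma> where "\<forall>i. \<exists>a\<in>arcs D. kappa D a = i \<and> phi D' (coloring a) + 1 = tvar (\<sigma> i)" by metis
  ultimately show ?thesis by metis
qed

text \<open>All maps are homomorphisms and the operations keep \<open>phi\<close> of the left
  argument, so the rule for arcs spreads to all of \<open>Q\<close>. This generality is needed to
  compose component maps, because \<open>g (q a)\<close> need not be a generator of
  \<open>Q'\<close>.\<close>

lemma phi_component_map:
  assumes "\<forall>a\<in>arcs D. phi D' (coloring a) + 1 = tvar (\<sigma> (kappa D a))"
    and "x \<in> carrier Q" and "phi D (p x) + 1 = tvar i"
  shows "phi D' (p' (g x)) + 1 = tvar (\<sigma> i)"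
proof -
  have "\<exists>i. phi D (p x) + 1 = tvar i \<and> phi D' (p' (g x)) + 1 = tvar (\<sigma> i)"
    using assms(2)
  proof (rule D.Q_induct)
    fix a assume "a \<in> arcs D"
    then show "\<exists>i. phi D (p (q a)) + 1 = tvar i \<and> phi D' (p' (g (q a))) + 1 = tvar (\<sigma> i)"
      using assms(1) by (auto simp: coloring_def D.p_q D.phi_gamma_arc)
  qed (simp_all add: D.p_hom g_hom D'.p_hom g_closed D.U_closed(3,4) D'.U_closed(3,4)
      D.p_in_U D'.p_in_U)
  then show ?thesis using assms(3) by (auto simp: tvar_eq_iff)
qed

text \<open>Both sides are homomorphisms on \<open>Q\<close> and agree on its generators. Through
  this square the module maps inherit invertibility from \<open>g\<close>, even where
  \<open>p\<close> and \<open>p'\<close> are not injective.\<close>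

lemma p_sequence_hom:
  assumes "diagram_pair D D' \<sigma>" and F: "sequence_hom \<sigma> D D' F"
    and arc: "\<And>a. a \<in> arcs D \<Longrightarrow> F (gamma_arc D a) = coloring a"
    and x: "x \<in> carrier Q"
  shows "F (p x) = p' (g x)"
proof -
  interpret diagram_pair D D' \<sigma> by fact
  show ?thesis
    using x by (rule D.Q_induct)
      (simp_all add: D.p_q arc coloring_def D.p_hom g_hom D'.p_hom g_closed D.p_in_U sequence_hom_quandle[OF F])
qed

lemma QA_sequence_hom:
  assumes "diagram_pair D D' \<sigma>" and F: "sequence_hom \<sigma> D D' F"
    and arc: "\<And>a. a \<in> arcs D \<Longrightarrow> F (gamma_arc D a) = coloring a"
    and x: "x \<in> carrier D.QA"
  shows "F x \<in> carrier D'.QA"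
proof -
  interpret diagram_pair D D' \<sigma> by fact
  show ?thesis
    using x
  proof (induction x rule: D.QA_induct)
    case (arc a)
    then show ?case by (simp add: assms(3) coloring_def D'.p_closed g_closed D.q_closed)
  qed (simp_all add: sequence_hom_quandle[OF F] D'.QA_closed subsetD[OF D.QA_subset_U])
qed

end

theorem marked_quandle_isomorphic:
  assumes "marked_quandle D Q p q" and "marked_quandle D' Q' p' q'" and "Q \<cong>\<^sub>Q Q'"
  shows "\<exists>\<sigma> F. diagram_pair D D' \<sigma> \<and>
    sequence_hom \<sigma> D D' F \<and> bij_betw F (carrier (alexander_module D)) (carrier (alexander_module D')) \<and>
    F ` carrier (fundamental_alexander_quandle D) = carrier (fundamental_alexander_quandle D')"
proof -
  interpret D: marked_quandle D Q p q by fact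
  interpret D': marked_quandle D' Q' p' q' by fact
  obtain f where f: "bij_betw f (carrier Q) (carrier Q')"
    "\<And>x y. \<lbrakk>x \<in> carrier Q; y \<in> carrier Q\<rbrakk> \<Longrightarrow> f (x \<triangleright>\<^bsub>Q\<^esub> y) = f x \<triangleright>\<^bsub>Q'\<^esub> f y"
    "\<And>x y. \<lbrakk>x \<in> carrier Q; y \<in> carrier Q\<rbrakk> \<Longrightarrow> f (x \<triangleleft>\<^bsub>Q\<^esub> y) = f x \<triangleleft>\<^bsub>Q'\<^esub> f y"
    using assms(3) unfolding quandle_isomorphic_def by blast
  define g where "g = inv_into (carrier Q) f"
  have fg: "x \<in> carrier Q \<Longrightarrow> f x \<in> carrier Q'" "x \<in> carrier Q \<Longrightarrow> g (f x) = x"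
    "y \<in> carrier Q' \<Longrightarrow> g y \<in> carrier Q" "y \<in> carrier Q' \<Longrightarrow> f (g y) = y" for x y
    using f(1) unfolding g_def bij_betw_def by (auto simp: inv_into_into f_inv_into_f)
  interpret f: marked_quandle_hom D Q p q D' Q' p' q' f
    by unfold_locales (simp_all add: f fg)
  interpret g: marked_quandle_hom D' Q' p' q' D Q p q g
  proof unfold_locales
    fix x y assume xy: "x \<in> carrier Q'" "y \<in> carrier Q'"
    show "g (x \<triangleright>\<^bsub>Q'\<^esub> y) = g x \<triangleright>\<^bsub>Q\<^esub> g y"
      using f(2)[of "g x" "g y"] fg(2)[of "g x \<triangleright>\<^bsub>Q\<^esub> g y"] xy by (simp add: fg D.Q_closed)
    show "g (x \<triangleleft>\<^bsub>Q'\<^esub> y) = g x \<triangleleft>\<^bsub>Q\<^esub> g y"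
      using f(3)[of "g x" "g y"] fg(2)[of "g x \<triangleleft>\<^bsub>Q\<^esub> g y"] xy by (simp add: fg D.Q_closed)
  qed (simp add: fg)
  obtain \<sigma> where \<sigma>: "\<forall>a\<in>arcs D. phi D' (f.coloring a) + 1 = tvar (\<sigma> (kappa D a))"
    using f.component_map by blast
  obtain \<tau> where \<tau>: "\<forall>a\<in>arcs D'. phi D (g.coloring a) + 1 = tvar (\<tau> (kappa D' a))"
    using g.component_map by blast
  \<comment> \<open>\<open>f\<close> and \<open>g\<close> cancel at \<open>q a\<close>, while the
    component index has passed through \<open>\<sigma>\<close> and then
    \<open>\<tau>\<close>.\<close>
  have \<tau>\<sigma>: "\<tau> (\<sigma> i) = i" for i
  proof -
    obtain a where a: "a \<in> arcs D" "kappa D a = i" using D.kappa_surj by blast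
    have i: "phi D (p (q a)) + 1 = tvar i" using a by (simp add: D.p_q D.phi_gamma_arc)
    have "phi D (p (g (f (q a)))) + 1 = tvar (\<tau> (\<sigma> i))"
      by (intro g.phi_component_map[OF \<tau>] f.phi_component_map[OF \<sigma> _ i] f.g_closed D.q_closed a)
    with i a show ?thesis by (simp add: fg D.q_closed tvar_eq_iff)
  qed
  have \<sigma>\<tau>: "\<sigma> (\<tau> i) = i" for i
  proof -
    obtain a where a: "a \<in> arcs D'" "kappa D' a = i" using D'.kappa_surj by blast
    have i: "phi D' (p' (q' a)) + 1 = tvar i" using a by (simp add: D'.p_q D'.phi_gamma_arc)
    have "phi D' (p' (f (g (q' a)))) + 1 = tvar (\<sigma> (\<tau> i))"
      by (intro f.phi_component_map[OF \<sigma>] g.phi_component_map[OF \<tau> _ i] g.g_closed D'.q_closed a)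
    with i a show ?thesis by (simp add: fg D'.q_closed tvar_eq_iff)
  qed
  have "bij \<sigma>" using \<tau>\<sigma> \<sigma>\<tau> by (intro o_bij[of \<tau>]) (simp_all add: fun_eq_iff)
  have \<tau>_eq: "\<tau> = inv_into UNIV \<sigma>" using \<tau>\<sigma> \<sigma>\<tau> by (intro inv_equality[symmetric])
  interpret pair: diagram_pair D D' \<sigma> by unfold_locales (rule \<open>bij \<sigma>\<close>)
  interpret swap: diagram_pair D' D \<tau> unfolding \<tau>_eq by (rule pair.diagram_pair_swap)
  obtain F where F: "sequence_hom \<sigma> D D' F" "\<And>a. a \<in> arcs D \<Longrightarrow> F (gamma_arc D a) = f.coloring a"
    using pair.sequence_hom_extension[of f.coloring] f.coloring_in_U f.coloring_crossing \<sigma> by metis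
  obtain G where G: "sequence_hom \<tau> D' D G" "\<And>a. a \<in> arcs D' \<Longrightarrow> G (gamma_arc D' a) = g.coloring a"
    using swap.sequence_hom_extension[of g.coloring] g.coloring_in_U g.coloring_crossing \<tau> by metis
  note Fp = f.p_sequence_hom[OF pair.diagram_pair_axioms F]
  note Gp = g.p_sequence_hom[OF swap.diagram_pair_axioms G]
  have GF: "G (F (gamma_arc D a)) = gamma_arc D a" if "a \<in> arcs D" for a
    using that by (simp add: F(2) f.coloring_def Gp fg D.q_closed D.p_q)
  have FG: "F (G (gamma_arc D' a)) = gamma_arc D' a" if "a \<in> arcs D'" for a
    using that by (simp add: G(2) g.coloring_def Fp fg D'.q_closed D'.p_q)
  have bij: "bij_betw F (carrier D.M) (carrier D'.M)"
    using pair.sequence_hom_bij[OF F(1) _ GF FG] G(1) by (simp add: \<tau>_eq)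
  have "F ` carrier D.QA = carrier D'.QA"
  proof (intro equalityI subsetI)
    fix y assume y: "y \<in> carrier D'.QA"
    have "G y \<in> carrier D.QA"
      by (rule g.QA_sequence_hom[OF swap.diagram_pair_axioms G(1) _ y]) (rule G(2))
    moreover have "F (G y) = y"
    proof (rule swap.sequence_hom_left_inverse[OF G(1)])
      show "sequence_hom (inv_into UNIV \<tau>) D D' F"
        using F(1) by (simp add: \<tau>_eq inv_inv_eq[OF \<open>bij \<sigma>\<close>])
      show "y \<in> carrier D'.M"
        using y D'.QA_subset_U by (auto simp: alexander_quandle_simps)
    qed (rule FG)
    ultimately show "y \<in> F ` carrier D.QA" by force
  next
    fix y assume "y \<in> F ` carrier D.QA"
    then show "y \<in> carrier D'.QA"
      using f.QA_sequence_hom[OF pair.diagram_pair_axioms F(1)] F(2) by blast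
  qed
  with pair.diagram_pair_axioms F(1) bij show ?thesis by blast
qed

section \<open>The two instances of the common frame\<close>

lemma (in tame_diagram) marked_fundamental_alexander_quandle:
  "marked_quandle D QA (\<lambda>x. x) (gamma_arc D)"
proof unfold_locales
  fix x and P :: "((real^2) set \<Rightarrow> 'm laurent) set \<Rightarrow> bool"
  assume "x \<in> carrier QA" and "\<And>a. a \<in> arcs D \<Longrightarrow> P (gamma_arc D a)"
    and "\<And>x y. \<lbrakk>x \<in> carrier QA; y \<in> carrier QA; P x; P y\<rbrakk> \<Longrightarrow> P (x \<triangleright>\<^bsub>QA\<^esub> y)"
    and "\<And>x y. \<lbrakk>x \<in> carrier QA; y \<in> carrier QA; P x; P y\<rbrakk> \<Longrightarrow> P (x \<triangleleft>\<^bsub>QA\<^esub> y)"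
  then show "P x" unfolding qop_QA qinv_QA by (rule QA_induct)
qed (simp_all add: gamma_arc_in_QA qop_QA qinv_QA QA_closed gamma_arc_crossing)

text \<open>The homomorphism on terms that induces the projection of the fundamental quandle onto
  \<open>QA\<close>.\<close>

primrec eval_term where
  "eval_term D (Gen a) = gamma_arc D a"
| "eval_term D (Op s t) = eval_term D s \<triangleright>\<^bsub>total_alexander_quandle D\<^esub> eval_term D t"
| "eval_term D (OpInv s t) = eval_term D s \<triangleleft>\<^bsub>total_alexander_quandle D\<^esub> eval_term D t"

context tame_diagram
begin

abbreviation "relations \<equiv>
  (\<lambda>c. (Op (Gen (right_arc D c)) (Gen (over_arc D c)), Gen (left_arc D c))) ` crossings D \<union>
  (\<lambda>c. (OpInv (Gen (left_arc D c)) (Gen (over_arc D c)), Gen (right_arc D c))) ` crossings D"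

lemma qterms_simps:
  "Gen a \<in> qterms A \<longleftrightarrow> a \<in> A"
  "Op s t \<in> qterms A \<longleftrightarrow> s \<in> qterms A \<and> t \<in> qterms A"
  "OpInv s t \<in> qterms A \<longleftrightarrow> s \<in> qterms A \<and> t \<in> qterms A"
  by (auto simp: qterms_def)

lemma eval_term_in_QA: "t \<in> qterms (arcs D) \<Longrightarrow> eval_term D t \<in> carrier QA"
  by (induction t) (simp_all add: qterms_simps gamma_arc_in_QA QA_closed)

text \<open>The first family of relations holds by \<open>gamma_arc_crossing\<close>, and (Q2) turns
  it into the second; the remaining rules are the quandle axioms of \<open>U\<close>.\<close>

lemma eval_term_qcong:
  assumes "qcong (arcs D) relations s t"
  shows "eval_term D s = eval_term D t"
proof -
  interpret quandle U by (rule quandle_U)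
  have U: "t \<in> qterms (arcs D) \<Longrightarrow> eval_term D t \<in> carrier U" for t
    using eval_term_in_QA QA_subset_U by blast
  have inv: "gamma_arc D (left_arc D c) \<triangleleft>\<^bsub>U\<^esub> gamma_arc D (over_arc D c) = gamma_arc D (right_arc D c)"
    if c: "c \<in> crossings D" for c
    unfolding gamma_arc_crossing[OF c, symmetric]
    by (intro Q2 gamma_arc_in_U right_arc_in_arcs[OF c] over_arc_in_arcs[OF c])
  show ?thesis
    using assms
  proof (induction rule: qcong.induct)
    case (rel s t)
    then show ?case by (auto simp: gamma_arc_crossing inv)
  next
    case (Q3 s t u)
    then show ?case by (simp only: eval_term.simps U quandle.Q3[OF quandle_U])
  qed (simp_all add: U Q1 Q2 Q2')
qed

lemma marked_fundamental_quandle: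
  "marked_quandle D (fundamental_quandle D) (\<lambda>X. eval_term D (SOME t. t \<in> X))
     (\<lambda>a. qclass (arcs D) relations (Gen a))"
proof -
  let ?Q = "fundamental_quandle D"
  let ?p = "\<lambda>X. eval_term D (SOME t. t \<in> X)"
  let ?cl = "qclass (arcs D) relations"
  have Q: "?Q = presented_quandle (arcs D) relations"
    by (simp add: fundamental_quandle_def)
  have carrier: "carrier ?Q = ?cl ` qterms (arcs D)"
    by (auto simp: Q presented_quandle_def quotient_def qclass_def)
  note ops = presented_quandle_ops[of _ "arcs D" _ relations, folded Q]
  \<comment> \<open>The chosen term is irrelevant because evaluation is constant on classes.\<close>
  have p: "?p (?cl t) = eval_term D t" if "t \<in> qterms (arcs D)" for t
  proof -
    have "t \<in> ?cl t" unfolding mem_qclass using that by (rule qcong.refl)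
    then have "(SOME s. s \<in> ?cl t) \<in> ?cl t"
      by (rule someI[where P="\<lambda>s. s \<in> ?cl t"])
    then have "qcong (arcs D) relations t (SOME s. s \<in> ?cl t)" unfolding mem_qclass .
    from eval_term_qcong[OF this] show ?thesis by (rule HOL.sym)
  qed
  show ?thesis
  proof unfold_locales
    fix x and P :: "(real^2) set qterm set \<Rightarrow> bool"
    assume x: "x \<in> carrier ?Q" and P: "\<And>a. a \<in> arcs D \<Longrightarrow> P (?cl (Gen a))"
      "\<And>x y. \<lbrakk>x \<in> carrier ?Q; y \<in> carrier ?Q; P x; P y\<rbrakk> \<Longrightarrow> P (x \<triangleright>\<^bsub>?Q\<^esub> y)"
      "\<And>x y. \<lbrakk>x \<in> carrier ?Q; y \<in> carrier ?Q; P x; P y\<rbrakk> \<Longrightarrow> P (x \<triangleleft>\<^bsub>?Q\<^esub> y)"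
    have "P (?cl t)" if "t \<in> qterms (arcs D)" for t
      using that
    proof (induction t)
      case (Op s t)
      then show ?case using P(2)[of "?cl s" "?cl t"] by (simp add: qterms_simps ops carrier)
    next
      case (OpInv s t)
      then show ?case using P(3)[of "?cl s" "?cl t"] by (simp add: qterms_simps ops carrier)
    qed (simp add: qterms_simps P(1))
    with x show "P x" by (auto simp: carrier)
  next
    fix c assume c: "c \<in> crossings D"
    then have arcs: "Gen (right_arc D c) \<in> qterms (arcs D)" "Gen (over_arc D c) \<in> qterms (arcs D)"
      "Gen (left_arc D c) \<in> qterms (arcs D)"
      by (simp_all add: qterms_simps right_arc_in_arcs over_arc_in_arcs left_arc_in_arcs)
    have "?cl (Op (Gen (right_arc D c)) (Gen (over_arc D c))) = ?cl (Gen (left_arc D c))"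
      using c arcs by (intro qclass_eq qcong.rel) (auto simp: qterms_simps)
    with arcs show "?cl (Gen (right_arc D c)) \<triangleright>\<^bsub>?Q\<^esub> ?cl (Gen (over_arc D c)) = ?cl (Gen (left_arc D c))"
      by (simp add: ops)
  qed (auto simp: carrier ops qterms_simps p eval_term_in_QA)
qed

end

section \<open>Reindexing components\<close>

context
  fixes \<sigma> :: "'m \<Rightarrow> 'n" and D :: "'n diagram"
  assumes bij: "bij \<sigma>"
begin

lemma shadow_reindex: "shadow (reindex \<sigma> D) i = shadow D (\<sigma> i)"
  by (simp add: shadow_def reindex_def fun_eq_iff)

lemma over_under_reindex:
  "double_point (reindex \<sigma> D) i s j t \<longleftrightarrow> double_point D (\<sigma> i) s (\<sigma> j) t"
  "over_under (reindex \<sigma> D) i s j t \<longleftrightarrow> over_under D (\<sigma> i) s (\<sigma> j) t"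
  using bij_is_inj[OF bij]
  by (auto simp: over_under_def double_point_def shadow_reindex height_def inj_eq) (simp_all add: reindex_def)

text \<open>Shaped after the quantifier prefix of \<open>under_ends_def\<close>; surjectivity of
  \<open>\<sigma>\<close> lets the component indices be written as \<open>\<sigma> i\<close> and
  \<open>\<sigma> j\<close>.\<close>

lemma ex_reindex:
  "(\<exists>i s j t v w. R i s j t v w) \<longleftrightarrow> (\<exists>i s j t v w. R (\<sigma> i) s (\<sigma> j) t v w)"
  by (metis surjD[OF bij_is_surj[OF bij]])

lemma crossings_reindex: "crossings (reindex \<sigma> D) = crossings D"
  unfolding crossings_def over_under_reindex shadow_reindex
  by (intro Collect_cong) (metis surjD[OF bij_is_surj[OF bij]])

lemma picture_reindex: "picture (reindex \<sigma> D) = picture D"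
proof -
  have "gap (reindex \<sigma> D) = gap D" by (simp add: reindex_def)
  then show ?thesis
    unfolding picture_def over_under_reindex shadow_reindex
    by (intro Collect_cong) (metis surjD[OF bij_is_surj[OF bij]])
qed

lemma arcs_reindex: "arcs (reindex \<sigma> D) = arcs D"
  and arc_at_reindex: "arc_at (reindex \<sigma> D) = arc_at D"
  and over_arc_reindex: "over_arc (reindex \<sigma> D) = over_arc D"
  by (simp_all add: arcs_def arc_at_def over_arc_def picture_reindex fun_eq_iff)

lemma under_ends_reindex: "under_ends (reindex \<sigma> D) = under_ends D"
proof -
  have "gap (reindex \<sigma> D) = gap D" by (simp add: reindex_def)
  then show ?thesis
    unfolding under_ends_def over_under_reindex shadow_reindex
    by (simp only:) (intro ext ex_reindex[symmetric])
qed

lemma right_arc_reindex: "right_arc (reindex \<sigma> D) = right_arc D"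
  and left_arc_reindex: "left_arc (reindex \<sigma> D) = left_arc D"
  by (simp_all add: right_arc_def left_arc_def under_ends_reindex arc_at_reindex fun_eq_iff)

text \<open>\<open>kappa\<close> is a definite description, so it has to be recomputed; the
  equivalence \<open>kappa_unique\<close> for all indices, and not just the value of
  \<open>kappa D a\<close>, makes this possible.\<close>

lemma kappa_reindex:
  assumes "tame_diagram D" and "a \<in> arcs D"
  shows "\<sigma> (kappa (reindex \<sigma> D) a) = kappa D a"
proof -
  interpret tame_diagram D by fact
  have "kappa (reindex \<sigma> D) a = (THE i. \<sigma> i = kappa D a)"
    unfolding kappa_def[of "reindex \<sigma> D"] shadow_reindex kappa_unique[OF assms(2)] ..
  also have "\<sigma> \<dots> = kappa D a"
    by (rule theI') (metis bij bij_iff)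
  finally show ?thesis .
qed

lemmas reindex_simps = crossings_reindex arcs_reindex over_arc_reindex right_arc_reindex left_arc_reindex

lemma tame_diagram_reindex:
  assumes "tame_diagram D"
  shows "tame_diagram (reindex \<sigma> D)"
proof -
  interpret tame_diagram D by fact
  note k = kappa_reindex[OF assms]
  have inj: "\<sigma> i = \<sigma> j \<longleftrightarrow> i = j" for i j using bij_is_inj[OF bij] by (simp add: inj_eq)
  have kappa_eq_iff: "kappa (reindex \<sigma> D) a = i \<longleftrightarrow> kappa D a = \<sigma> i" if "a \<in> arcs D" for a i
    using k[OF that] inj by metis
  show ?thesis
  proof (unfold_locales, unfold reindex_simps)
    show "\<exists>a\<in>arcs D. kappa (reindex \<sigma> D) a = i" for i
      using kappa_surj[of "\<sigma> i"] kappa_eq_iff by blast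
    show "a \<subseteq> range (shadow (reindex \<sigma> D) i) \<longleftrightarrow> i = kappa (reindex \<sigma> D) a"
      if "a \<in> arcs D" for a i
      unfolding shadow_reindex kappa_unique[OF that] using kappa_eq_iff[OF that, of i] by metis
    show "kappa (reindex \<sigma> D) (left_arc D c) = kappa (reindex \<sigma> D) (right_arc D c)"
      if "c \<in> crossings D" for c
      using kappa_left_arc[OF that] k right_arc_in_arcs[OF that] left_arc_in_arcs[OF that]
      by (simp add: kappa_eq_iff)
    show "P b" if "\<And>c. c \<in> crossings D \<Longrightarrow> P (right_arc D c) \<longleftrightarrow> P (left_arc D c)"
      "a \<in> arcs D" "b \<in> arcs D" "kappa (reindex \<sigma> D) a = kappa (reindex \<sigma> D) b" "P a" for P a b
      using arcs_connected[of P, OF that(1,2,3) _ that(5)] that(4) k[OF that(2)] k[OF that(3)] by simp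
  qed (simp_all add: finite_arcs finite_crossings over_arc_in_arcs right_arc_in_arcs left_arc_in_arcs)
qed

text \<open>The two diagrams share their arcs and crossings and differ in the names of the
  variables. The identity on arcs is thus an admissible colouring in both directions, and its two
  extensions are inverse to each other on generators.\<close>

lemma reindex_sequence_iso:
  assumes "tame_diagram D"
  shows "\<exists>F. sequence_hom \<sigma> (reindex \<sigma> D) D F \<and>
      bij_betw F (carrier (alexander_module (reindex \<sigma> D))) (carrier (alexander_module D))"
    and "\<exists>F. sequence_hom (inv_into UNIV \<sigma>) D (reindex \<sigma> D) F \<and>
      bij_betw F (carrier (alexander_module D)) (carrier (alexander_module (reindex \<sigma> D)))"
proof -
  interpret D: tame_diagram D by fact
  interpret E: tame_diagram "reindex \<sigma> D" by (rule tame_diagram_reindex[OF assms])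
  interpret ED: diagram_pair "reindex \<sigma> D" D \<sigma> by unfold_locales (rule bij)
  interpret DE: diagram_pair D "reindex \<sigma> D" "inv_into UNIV \<sigma>" by (rule ED.diagram_pair_swap)
  have k: "kappa (reindex \<sigma> D) a = inv_into UNIV \<sigma> (kappa D a)" if "a \<in> arcs D" for a
    using kappa_reindex[OF assms that] inv_f_f[OF bij_is_inj[OF bij]] by metis
  obtain F where F: "sequence_hom \<sigma> (reindex \<sigma> D) D F"
      "\<And>a. a \<in> arcs D \<Longrightarrow> F (gamma_arc (reindex \<sigma> D) a) = gamma_arc D a"
    using ED.sequence_hom_extension[of "gamma_arc D"] D.gamma_arc_in_U D.gamma_arc_crossing
    by (auto simp: reindex_simps D.phi_gamma_arc kappa_reindex[OF assms])
  obtain G where G: "sequence_hom (inv_into UNIV \<sigma>) D (reindex \<sigma> D) G"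
      "\<And>a. a \<in> arcs D \<Longrightarrow> G (gamma_arc D a) = gamma_arc (reindex \<sigma> D) a"
    using DE.sequence_hom_extension[of "gamma_arc (reindex \<sigma> D)"] E.gamma_arc_in_U E.gamma_arc_crossing
    by (auto simp: reindex_simps E.phi_gamma_arc k)
  have id: "a \<in> arcs (reindex \<sigma> D) \<Longrightarrow> G (F (gamma_arc (reindex \<sigma> D) a)) = gamma_arc (reindex \<sigma> D) a"
    "a \<in> arcs D \<Longrightarrow> F (G (gamma_arc D a)) = gamma_arc D a" for a
    by (simp_all add: F G reindex_simps)
  show "\<exists>F. sequence_hom \<sigma> (reindex \<sigma> D) D F \<and>
      bij_betw F (carrier (alexander_module (reindex \<sigma> D))) (carrier (alexander_module D))"
    using F(1) ED.sequence_hom_bij[OF F(1) G(1) id] by blast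
  show "\<exists>F. sequence_hom (inv_into UNIV \<sigma>) D (reindex \<sigma> D) F \<and>
      bij_betw F (carrier (alexander_module D)) (carrier (alexander_module (reindex \<sigma> D)))"
    using G(1) DE.sequence_hom_bij[OF G(1) _ id(2,1)] F(1) by (auto simp: inv_inv_eq[OF bij])
qed

end

text \<open>Along the identity relabelling semilinear means linear, so composites of semilinear
  isomorphisms can be turned into equivalences of sequences.\<close>

lemma module_sequences_equivalent_iff:
  "module_sequences_equivalent D D' \<longleftrightarrow>
    (\<exists>f. sequence_hom id D D' f \<and> bij_betw f (carrier (alexander_module D)) (carrier (alexander_module D')))"
proof -
  have "f \<in> linear_iso Lambda (alexander_module D) (alexander_module D') \<and>
      (\<forall>x\<in>carrier (alexander_module D). phi D x = phi D' (f x)) \<longleftrightarrow>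
    sequence_hom id D D' f \<and> bij_betw f (carrier (alexander_module D)) (carrier (alexander_module D'))" for f
    by (auto simp: linear_iso_def sequence_hom_def relabel_id Lambda_simps bij_betw_def)
  then show ?thesis unfolding module_sequences_equivalent_def by blast
qed

section \<open>The implications for tame diagrams\<close>

theorem tame_diagram_implications:
  fixes D :: "'m diagram" and D' :: "'n diagram"
  assumes "tame_diagram D" and "tame_diagram D'"
  shows "fundamental_quandle D \<cong>\<^sub>Q fundamental_quandle D' \<Longrightarrow>
      fundamental_alexander_quandle D \<cong>\<^sub>Q fundamental_alexander_quandle D'"
    and "fundamental_alexander_quandle D \<cong>\<^sub>Q fundamental_alexander_quandle D' \<Longrightarrow>
      \<exists>\<sigma> :: 'm \<Rightarrow> 'n. bij \<sigma> \<and> module_sequences_equivalent D (reindex \<sigma> D')"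
    and "\<exists>\<sigma> :: 'm \<Rightarrow> 'n. bij \<sigma> \<and> module_sequences_equivalent D (reindex \<sigma> D') \<Longrightarrow>
      total_alexander_quandle D \<cong>\<^sub>Q total_alexander_quandle D'"
proof -
  interpret D: tame_diagram D by fact
  interpret D': tame_diagram D' by fact
  show "D.QA \<cong>\<^sub>Q D'.QA" if "fundamental_quandle D \<cong>\<^sub>Q fundamental_quandle D'"
    using marked_quandle_isomorphic[OF D.marked_fundamental_quandle D'.marked_fundamental_quandle that]
      diagram_pair.QA_isomorphic by blast
  show "\<exists>\<sigma> :: 'm \<Rightarrow> 'n. bij \<sigma> \<and> module_sequences_equivalent D (reindex \<sigma> D')"
    if iso: "D.QA \<cong>\<^sub>Q D'.QA"
  proof -
    obtain \<sigma> :: "'m \<Rightarrow> 'n" and F where pair: "diagram_pair D D' \<sigma>"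
      and F: "sequence_hom \<sigma> D D' F" "bij_betw F (carrier D.M) (carrier D'.M)"
      using marked_quandle_isomorphic[OF D.marked_fundamental_alexander_quandle
          D'.marked_fundamental_alexander_quandle iso] by blast
    have "bij \<sigma>" using pair by (simp add: diagram_pair_def diagram_pair_axioms_def)
    obtain G where G: "sequence_hom (inv_into UNIV \<sigma>) D' (reindex \<sigma> D') G"
      "bij_betw G (carrier D'.M) (carrier (alexander_module (reindex \<sigma> D')))"
      using reindex_sequence_iso(2)[OF \<open>bij \<sigma>\<close> D'.tame_diagram_axioms] by blast
    \<comment> \<open>\<open>F\<close> renames variables by \<open>\<sigma>\<close> and
      \<open>G\<close> renames them back, so the composite is linear over one ring.\<close>
    have "sequence_hom id D (reindex \<sigma> D') (G \<circ> F)"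
      using F(1) G(1) by (rule sequence_hom_comp) (simp add: relabel_inverse[OF \<open>bij \<sigma>\<close>] relabel_id)
    moreover have "bij_betw (G \<circ> F) (carrier D.M) (carrier (alexander_module (reindex \<sigma> D')))"
      using F(2) G(2) by (rule bij_betw_trans)
    ultimately show ?thesis
      unfolding module_sequences_equivalent_iff using \<open>bij \<sigma>\<close> by blast
  qed
  show "D.U \<cong>\<^sub>Q D'.U"
    if equiv: "\<exists>\<sigma> :: 'm \<Rightarrow> 'n. bij \<sigma> \<and> module_sequences_equivalent D (reindex \<sigma> D')"
  proof -
    obtain \<sigma> :: "'m \<Rightarrow> 'n" and F where "bij \<sigma>" and F: "sequence_hom id D (reindex \<sigma> D') F"
      "bij_betw F (carrier D.M) (carrier (alexander_module (reindex \<sigma> D')))"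
      using equiv unfolding module_sequences_equivalent_iff by blast
    interpret E: tame_diagram "reindex \<sigma> D'"
      by (rule tame_diagram_reindex[OF \<open>bij \<sigma>\<close> D'.tame_diagram_axioms])
    interpret DE: diagram_pair D "reindex \<sigma> D'" id by unfold_locales simp
    interpret ED': diagram_pair "reindex \<sigma> D'" D' \<sigma> by unfold_locales (rule \<open>bij \<sigma>\<close>)
    obtain G where "sequence_hom \<sigma> (reindex \<sigma> D') D' G"
      "bij_betw G (carrier E.M) (carrier D'.M)"
      using reindex_sequence_iso(1)[OF \<open>bij \<sigma>\<close> D'.tame_diagram_axioms] by blast
    from DE.U_isomorphic[OF F] ED'.U_isomorphic[OF this] show ?thesis
      by (rule quandle_isomorphic_trans)
  qed
qed

section \<open>Diagrams of links\<close>

text \<open>The squared norm of the image is \<open>2 / (1 - x$4) - 1\<close>. It recovers the last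
  coordinate, and then the others follow.\<close>

lemma stereo_inject:
  assumes "x \<in> sphere 0 1" "y \<in> sphere 0 1" "x \<noteq> axis 4 1" "y \<noteq> axis 4 1" "stereo x = stereo y"
  shows "x = y"
proof -
  have sq: "(z$1)^2 + (z$2)^2 + (z$3)^2 + (z$4)^2 = 1" if "z \<in> sphere 0 1" for z :: "real^4"
    using that by (simp add: norm_eq_1 inner_vec_def sum_4 power2_eq_square)
  have neq: "z$4 \<noteq> 1" if "z \<in> sphere 0 1" "z \<noteq> axis 4 1" for z :: "real^4"
  proof
    assume "z$4 = 1"
    with sq[OF that(1)] have "(z$1)^2 + (z$2)^2 + (z$3)^2 = 0" by simp
    then have "z$1 = 0 \<and> z$2 = 0 \<and> z$3 = 0"
      by (metis add_nonneg_eq_0_iff add_nonneg_nonneg zero_le_power2 power_eq_0_iff)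
    with \<open>z$4 = 1\<close> have "z = axis 4 1" by (simp add: vec_eq_iff forall_4 axis_def)
    with that(2) show False by simp
  qed
  define u v where "u = 1 - x$4" and "v = 1 - y$4"
  have uv: "u \<noteq> 0" "v \<noteq> 0" using neq assms by (simp_all add: u_def v_def)
  have eq: "x$1 / u = y$1 / v" "x$2 / u = y$2 / v" "x$3 / u = y$3 / v"
    using assms(5) unfolding stereo_def u_def[symmetric] v_def[symmetric]
    by (simp_all add: vec_eq_iff forall_3)
  have norm: "(z$1 / w)^2 + (z$2 / w)^2 + (z$3 / w)^2 = 2 / w - 1"
    if "z \<in> sphere 0 1" "w = 1 - z$4" "w \<noteq> 0" for z :: "real^4" and w
  proof -
    have "(z$1)^2 + (z$2)^2 + (z$3)^2 = 1 - (1 - w)^2" using sq[OF that(1)] that(2) by simp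
    also have "\<dots> = 2 * w - w^2" by (simp add: power2_eq_square algebra_simps)
    finally have "((z$1)^2 + (z$2)^2 + (z$3)^2) / w^2 = (2 * w - w^2) / w^2" by simp
    then show ?thesis using that(3)
      by (simp add: power_divide add_divide_distrib diff_divide_distrib power2_eq_square)
  qed
  have "2 / u - 1 = 2 / v - 1"
    using norm[OF assms(1) u_def uv(1)] norm[OF assms(2) v_def uv(2)] eq by simp
  then have "u = v" using uv by (simp add: field_simps)
  with eq uv have "x$1 = y$1" "x$2 = y$2" "x$3 = y$3" "x$4 = y$4" by (simp_all add: u_def v_def)
  then show "x = y" by (simp add: vec_eq_iff forall_4)
qed

section \<open>Continuity of closed piecewise smooth curves\<close>

lemma smooth_arc_continuous_on:
  assumes "smooth_arc g a b"
  shows "continuous_on {a..b} g"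
proof -
  obtain d where d: "d 0 = g"
    "\<And>k t. t \<in> {a..b} \<Longrightarrow> (d k has_vector_derivative d (Suc k) t) (at t within {a..b})"
    using assms unfolding smooth_arc_def by blast
  have "(g has_vector_derivative d 1 t) (at t within {a..b})" if "t \<in> {a..b}" for t
    using d(2)[OF that, of 0] d(1) by simp
  then show ?thesis
    unfolding continuous_on_eq_continuous_within using has_vector_derivative_continuous by blast
qed

text \<open>The closed intervals between consecutive break points form a finite cover of
  \<open>{0..1}\<close>, on which continuity glues.\<close>

lemma piecewise_smooth_continuous_on:
  assumes "piecewise_smooth g"
  shows "continuous_on {0..1} g"
proof -
  obtain S where S': "finite S \<and> {0, 1} \<subseteq> S \<and> S \<subseteq> {0..1} \<and>
      (\<forall>a\<in>S. \<forall>b\<in>S. a < b \<and> {a<..<b} \<inter> S = {} \<longrightarrow> smooth_arc g a b)"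
    using assms unfolding piecewise_smooth_def ..
  note S = S'[THEN conjunct1] S'[THEN conjunct2, THEN conjunct1]
    S'[THEN conjunct2, THEN conjunct2, THEN conjunct2]
  define I where "I = {(a, b) \<in> S \<times> S. a < b \<and> {a<..<b} \<inter> S = {}}"
  have "finite I" unfolding I_def using S(1) by (intro finite_subset[OF _ finite_cartesian_product]) auto
  moreover have "\<forall>ab\<in>I. continuous_on {fst ab..snd ab} g"
  proof
    fix ab assume "ab \<in> I"
    then have "smooth_arc g (fst ab) (snd ab)" using S(3) by (simp add: I_def case_prod_beta)
    then show "continuous_on {fst ab..snd ab} g" by (rule smooth_arc_continuous_on)
  qed
  ultimately have "continuous_on (\<Union>ab\<in>I. {fst ab..snd ab}) g"
    by (intro continuous_on_closed_Union) auto
  moreover have "{0..1} \<subseteq> (\<Union>ab\<in>I. {fst ab..snd ab})"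
  proof
    fix x :: real assume x: "x \<in> {0..1}"
    have ex: "\<exists>a\<in>S. \<exists>b\<in>S. a \<le> x \<and> x \<le> b \<and> a < b \<and> {a<..<b} \<inter> S = {}"
    \<comment> \<open>No break point follows \<open>1\<close>, so the last interval is used there;
      any other point has a break point strictly to its right.\<close>
    proof (cases "x = 1")
      case True
      define a where "a = Max {s \<in> S. s < 1}"
      have A: "finite {s \<in> S. s < 1}" "0 \<in> {s \<in> S. s < 1}" using S(1,2) by auto
      then have "a \<in> {s \<in> S. s < 1}" unfolding a_def by (metis Max_in empty_iff)
      then have a: "a \<in> S" "a < 1" by simp_all
      have le: "s \<le> a" if "s \<in> S" "s < 1" for s unfolding a_def using A(1) that by simp
      have "{a<..<1} \<inter> S = {}"
      proof (rule equals0I)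
        fix s assume "s \<in> {a<..<1} \<inter> S"
        then show False using le[of s] by simp
      qed
      with a True S(2) show ?thesis by (intro bexI[of _ a] bexI[of _ 1]) auto
    next
      case False
      define a where "a = Max {s \<in> S. s \<le> x}"
      define b where "b = Min {s \<in> S. s > x}"
      have A: "finite {s \<in> S. s \<le> x}" "0 \<in> {s \<in> S. s \<le> x}"
        "finite {s \<in> S. s > x}" "1 \<in> {s \<in> S. s > x}" using S(1,2) x False by auto
      have "a \<in> {s \<in> S. s \<le> x}" unfolding a_def using A(1,2) by (metis Max_in empty_iff)
      then have a: "a \<in> S" "a \<le> x" by simp_all
      have "b \<in> {s \<in> S. s > x}" unfolding b_def using A(3,4) by (metis Min_in empty_iff)
      then have b: "b \<in> S" "x < b" by simp_all
      have le: "s \<le> a" if "s \<in> S" "s \<le> x" for s unfolding a_def using A(1) that by simp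
      have ge: "b \<le> s" if "s \<in> S" "x < s" for s unfolding b_def using A(3) that by simp
      have "{a<..<b} \<inter> S = {}"
      proof (rule equals0I)
        fix s assume "s \<in> {a<..<b} \<inter> S"
        then show False using le[of s] ge[of s] by (cases "s \<le> x") simp_all
      qed
      with a b show ?thesis by (intro bexI[of _ a] bexI[of _ b]) auto
    qed
    then show "x \<in> (\<Union>ab\<in>I. {fst ab..snd ab})" unfolding I_def by force
  qed
  ultimately show ?thesis by (rule continuous_on_subset)
qed

lemma periodic_Ints:
  assumes "\<And>t. f (t + 1) = f t" and "n \<in> \<int>"
  shows "f (t + n) = f (t :: real)"
proof -
  have nat: "f (t + of_nat k) = f t" for t and k
  proof (induction k)
    case (Suc k)
    have "f (t + of_nat (Suc k)) = f ((t + of_nat k) + 1)" by (simp add: ac_simps)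
    then show ?case unfolding assms(1) Suc .
  qed simp
  obtain k where n: "n = of_int k" using assms(2) by (auto elim: Ints_cases)
  show ?thesis
  proof (cases "k \<ge> 0")
    case True
    then show ?thesis using nat[of t "nat k"] by (simp add: n)
  next
    case False
    then show ?thesis using nat[of "t + n" "nat (- k)"] by (simp add: n)
  qed
qed

lemma periodic_continuous_on:
  fixes f :: "real \<Rightarrow> 'a::topological_space"
  assumes per: "\<And>t. f (t + 1) = f t" and cont: "continuous_on {0..1} f"
  shows "continuous_on UNIV f"
proof -
  have piece: "continuous_on {of_int n..of_int n + 1} f" for n :: int
  proof -
    have "continuous_on {of_int n..of_int n + 1} (\<lambda>t. f (t + of_int (- n)))"
      by (rule continuous_on_compose2[OF cont]) (auto intro: continuous_intros)
    then show ?thesis using periodic_Ints[of f, OF per, of "of_int (- n)"] by simp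
  qed
  have "isCont f t" for t
  proof -
    define n where "n = \<lfloor>t\<rfloor>"
    \<comment> \<open>Two neighbouring unit intervals are joined so that \<open>t\<close> is an
      interior point even when it is an integer.\<close>
    have "continuous_on ({of_int (n - 1)..of_int (n - 1) + 1} \<union> {of_int n..of_int n + 1}) f"
      by (intro continuous_on_closed_Un piece) auto
    moreover have "{of_int (n - 1)..of_int (n - 1) + 1} \<union> {of_int n..of_int n + 1}
      = {of_int n - 1..of_int n + (1::real)}" by auto
    moreover have "t \<in> interior {of_int n - 1..of_int n + (1::real)}"
      unfolding n_def interior_atLeastAtMost_real by simp linarith
    ultimately show ?thesis using continuous_on_interior by metis
  qed
  then show ?thesis by (simp add: continuous_at_imp_continuous_on)
qed

text \<open>What is kept of the link after projection to the plane. Finiteness of the index type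
  makes the union of the other strands closed and the set of arcs finite.\<close>

locale regular_diagram =
  fixes D :: "'m::finite diagram"
  assumes continuous_shadow: "continuous_on UNIV (shadow D i)"
    and shadow_shift: "n \<in> \<int> \<Longrightarrow> shadow D i (t + n) = shadow D i t"
    and height_shift: "n \<in> \<int> \<Longrightarrow> height D i (t + n) = height D i t"
    and height_neq: "double_point D i s j t \<Longrightarrow> height D i s \<noteq> height D j t"
    and regular: "regular_projection D"
    and short: "short_gap D"

text \<open>Rotations are injective and stereographic projection is injective off the pole, so the
  space curves meet only where the link does. A double point with equal heights would be such a
  meeting.\<close>

lemma regular_diagram_of_link:
  fixes L :: "'m::finite \<Rightarrow> real \<Rightarrow> real^4"
  assumes "link L" and "diagram_of D L"
  shows "regular_diagram D"
proof -
  obtain R :: "real^4^4" where R: "rotation_matrix R" "\<And>i t. R *v L i t \<noteq> axis 4 1"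
    "space_curve D = (\<lambda>i t. stereo (R *v L i t))"
    and reg: "regular_projection D" "short_gap D"
    using assms(2) unfolding diagram_of_def by blast
  have sph: "L i t \<in> sphere 0 1" and inj: "L i s = L j t \<longleftrightarrow> i = j \<and> s - t \<in> \<int>" for i s j t
    using assms(1) unfolding link_def by blast+
  have orth: "orthogonal_transformation ((*v) R)"
    using R(1) by (simp add: rotation_matrix_def orthogonal_transformation_matrix matrix_of_matrix_vector_mul)
  have curve: "space_curve D i s = space_curve D j t \<longleftrightarrow> i = j \<and> s - t \<in> \<int>" for i s j t
  proof
    have sph': "R *v L i t \<in> sphere 0 1" for i t
      using sph[of i t] orthogonal_transformation_norm[OF orth] by simp
    assume "space_curve D i s = space_curve D j t"
    then have "R *v L i s = R *v L j t"
      using stereo_inject[OF sph' sph' R(2) R(2)] by (simp add: R(3))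
    then have "L i s = L j t"
      using orthogonal_transformation_inj[OF orth] by (simp add: inj_eq)
    then show "i = j \<and> s - t \<in> \<int>" by (simp only: inj)
  next
    assume "i = j \<and> s - t \<in> \<int>"
    then show "space_curve D i s = space_curve D j t" by (simp add: R(3) inj[symmetric])
  qed
  have per: "space_curve D i (t + n) = space_curve D i t" if "n \<in> \<int>" for i t n
    using that by (simp add: curve)
  show ?thesis
  proof
    show "shadow D i (t + n) = shadow D i t" "height D i (t + n) = height D i t"
      if "n \<in> \<int>" for i t n
      using that by (simp_all add: shadow_def height_def per)
    then have "shadow D i (t + 1) = shadow D i t" for i t by simp
    moreover have "piecewise_smooth (shadow D i)" for i
      using reg(1) by (simp add: regular_projection_def)
    ultimately show "continuous_on UNIV (shadow D i)" for i
      by (intro periodic_continuous_on piecewise_smooth_continuous_on)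
    show "height D i s \<noteq> height D j t" if "double_point D i s j t" for i s j t
    proof
      assume "height D i s = height D j t"
      moreover have "shadow D i s = shadow D j t" using that by (simp add: double_point_def)
      ultimately have "space_curve D i s = space_curve D j t"
        by (simp add: height_def shadow_def vec_eq_iff forall_2 forall_3)
      with that show False by (simp add: curve double_point_def)
    qed
  qed (fact reg)+
qed

text \<open>The weak inequality makes this set closed; closed disjoint strands are what separates
  the arcs of different components.\<close>

definition allowed :: "'m diagram \<Rightarrow> 'm \<Rightarrow> real set" where
  "allowed D j = {r. \<forall>i s t. over_under D i s j t \<longrightarrow> gap D \<le> \<bar>r - t\<bar>}"

definition strand :: "'m diagram \<Rightarrow> 'm \<Rightarrow> (real^2) set" where
  "strand D j = shadow D j ` allowed D j"

lemma picture_eq: "picture D = (\<Union>j. strand D j)"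
  by (auto simp: picture_def strand_def allowed_def)

lemma double_point_commute: "double_point D i s j t \<longleftrightarrow> double_point D j t i s"
proof -
  have "s - t \<in> \<int> \<longleftrightarrow> t - s \<in> \<int>" by (metis Ints_minus minus_diff_eq)
  then show ?thesis by (auto simp: double_point_def)
qed

section \<open>Crossings, strands and arcs of a regular diagram\<close>

context regular_diagram
begin

abbreviation "arc_of j r \<equiv> arc_at D (shadow D j r)"

lemma gap_pos: "0 < gap D"
  using short by (simp add: short_gap_def)

lemma double_point_unique:
  assumes "double_point D i s j t" and "double_point D i s k u"
  shows "k = j" and "t - u \<in> \<int>"
  using regular assms unfolding regular_projection_def by blast+

lemma double_point_cases:
  assumes "double_point D i s j t"
  shows "over_under D i s j t \<or> over_under D j t i s"
  using height_neq[OF assms] assms double_point_commute[of D i s j t] by (auto simp: over_under_def)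

lemma double_point_shift:
  assumes "n \<in> \<int>" and "m \<in> \<int>"
  shows "double_point D i (s + n) j (t + m) \<longleftrightarrow> double_point D i s j t"
proof -
  have "(s - t) + (n - m) \<in> \<int> \<longleftrightarrow> s - t \<in> \<int>"
    using assms by (metis Ints_add Ints_diff add_diff_cancel_right')
  moreover have "s + n - (t + m) = (s - t) + (n - m)" by simp
  ultimately have "s + n - (t + m) \<in> \<int> \<longleftrightarrow> s - t \<in> \<int>" by (simp only:)
  with assms show ?thesis by (simp only: double_point_def shadow_shift)
qed

lemma over_under_shift:
  assumes "n \<in> \<int>" and "m \<in> \<int>"
  shows "over_under D i (s + n) j (t + m) \<longleftrightarrow> over_under D i s j t"
  using assms by (simp add: over_under_def double_point_shift height_shift)

lemma shadow_height_cong: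
  assumes "s - s' \<in> \<int>"
  shows "shadow D i s = shadow D i s'" and "height D i s = height D i s'"
  using shadow_shift[OF assms, of i s'] height_shift[OF assms, of i s'] by simp_all

text \<open>By regularity a crossing parameter has only one partner up to periods, so
  \<open>k\<close>, \<open>u\<close> would be \<open>j\<close>, \<open>t\<close>, and each height
  would exceed the other.\<close>

lemma over_not_under:
  assumes "over_under D i s j t" and "over_under D k u i s'" and "s - s' \<in> \<int>"
  shows False
proof -
  have "s' - s \<in> \<int>" using Ints_minus[OF assms(3)] by simp
  then have "over_under D k u i s"
    using over_under_shift[of 0 "s' - s" k u i s] assms(2) by simp
  then have "double_point D i s k u" "height D k u > height D i s"
    using double_point_commute[of D i s k u] by (simp_all add: over_under_def)
  with assms(1) double_point_unique[of i s j t k u] shadow_height_cong(2)[of t u j]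
  show False by (simp add: over_under_def)
qed

text \<open>If the two overpassing parameters were not equal up to a period, they would be partners
  at a double point, and one of them would also be an underpass. This makes the right and left arcs
  of a crossing well defined.\<close>

lemma over_under_unique:
  assumes "over_under D i s j t" and "over_under D i' s' j' t'"
    and "shadow D i s = shadow D i' s'"
  shows "i' = i" and "s - s' \<in> \<int>" and "j' = j" and "t - t' \<in> \<int>"
proof -
  have dp: "double_point D i s j t" "double_point D i' s' j' t'"
    using assms by (simp_all add: over_under_def)
  have same: "i' = i \<and> s - s' \<in> \<int>"
  proof (rule ccontr)
    assume "\<not> (i' = i \<and> s - s' \<in> \<int>)"
    then have 1: "double_point D i s i' s'" using assms(3) by (auto simp: double_point_def)
    have "j = i'" "s' - t \<in> \<int>" using double_point_unique[OF 1 dp(1)] by simp_all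
    then show False using over_not_under[OF assms(2), of i s t] assms(1) by simp
  qed
  then have 0: "s - s' \<in> \<int>" by simp
  have "double_point D i s j' t'"
    using dp(2) same double_point_shift[OF 0 Ints_0, of i s' j' t'] by simp
  with double_point_unique[OF dp(1) this] same
  show "i' = i" "s - s' \<in> \<int>" "j' = j" "t - t' \<in> \<int>" by simp_all
qed

lemma underpass_gap:
  assumes "over_under D i s j t" and "double_point D j r k u" and "r \<noteq> t"
  shows "\<bar>r - t\<bar> > 2 * gap D"
  using short assms unfolding short_gap_def by blast

text \<open>The reason for the factor 2 in \<open>short_gap\<close>: an underpass closer than
  \<open>gap D\<close> to \<open>r\<close> would be closer than \<open>2 * gap D\<close> to
  \<open>s\<close>.\<close>

lemma over_near_allowed:
  assumes "over_under D i s j t" and "\<bar>r - s\<bar> \<le> gap D"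
  shows "r \<in> allowed D i"
  unfolding allowed_def
proof clarify
  fix k u t0 assume o: "over_under D k u i t0"
  have "s \<noteq> t0" using over_not_under[OF assms(1) o] by auto
  moreover have "double_point D i s j t" using assms(1) by (simp add: over_under_def)
  ultimately have "\<bar>s - t0\<bar> > 2 * gap D" using underpass_gap[OF o] by blast
  with assms(2) show "gap D \<le> \<bar>r - t0\<bar>" by linarith
qed

text \<open>Other underpasses are more than \<open>2 * gap D\<close> from \<open>t\<close>, hence
  more than \<open>gap D\<close> from the ends; the distance to \<open>t\<close> itself is exactly
  \<open>gap D\<close>, the boundary case of \<open>allowed\<close>.\<close>

lemma under_ends_allowed:
  assumes "over_under D i s j t"
  shows "t - gap D \<in> allowed D j" and "t + gap D \<in> allowed D j"
proof -
  have *: "t = t0 \<or> \<bar>t - t0\<bar> > 2 * gap D" if o: "over_under D k u j t0" for k u t0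
    using underpass_gap[OF o] assms double_point_commute[of D i s j t] by (auto simp: over_under_def)
  show "t - gap D \<in> allowed D j" "t + gap D \<in> allowed D j"
    unfolding allowed_def using * gap_pos by (auto; fastforce)+
qed

lemma allowed_shift:
  assumes "n \<in> \<int>"
  shows "r + n \<in> allowed D j \<longleftrightarrow> r \<in> allowed D j"
proof -
  have *: "r + n \<in> allowed D j" if n: "n \<in> \<int>" and r: "r \<in> allowed D j" for r n
    unfolding allowed_def
  proof clarify
    fix i s t assume "over_under D i s j t"
    then have "over_under D i s j (t + - n)"
      using over_under_shift[of 0 "- n" i s j t] n by simp
    then have "gap D \<le> \<bar>r - (t + - n)\<bar>" using r unfolding allowed_def by blast
    then show "gap D \<le> \<bar>r + n - t\<bar>" by (simp add: algebra_simps)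
  qed
  from *[OF assms, of r] *[of "- n" "r + n"] assms show ?thesis by auto
qed

text \<open>At a double point one parameter is an underpass, and its distance
  \<open>0 < gap D\<close> to itself shows that it was removed.\<close>

lemma strand_disjoint:
  assumes "r \<in> allowed D i" and "u \<in> allowed D j" and "shadow D i r = shadow D j u"
  shows "i = j \<and> r - u \<in> \<int>"
proof (rule ccontr)
  assume "\<not> (i = j \<and> r - u \<in> \<int>)"
  then have "double_point D i r j u" using assms(3) by (simp add: double_point_def)
  then have "over_under D i r j u \<or> over_under D j u i r" by (rule double_point_cases)
  then show False using assms(1,2) gap_pos unfolding allowed_def by force
qed

text \<open>Parameters from one period suffice, and those that are allowed form a compact
  set.\<close>

lemma closed_strand: "closed (strand D j)"
proof -
  have "closed (allowed D j)"
    unfolding allowed_def by (intro closed_Collect_all closed_Collect_imp open_Collect_const closed_Collect_le continuous_intros)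
  then have "compact (allowed D j \<inter> {0..1})"
    by (intro closed_Int_compact) auto
  then have "compact (shadow D j ` (allowed D j \<inter> {0..1}))"
    by (intro compact_continuous_image continuous_on_subset[OF continuous_shadow]) auto
  moreover have "strand D j = shadow D j ` (allowed D j \<inter> {0..1})"
  proof (unfold strand_def, intro equalityI subsetI)
    fix p assume "p \<in> shadow D j ` allowed D j"
    then obtain r where r: "r \<in> allowed D j" "p = shadow D j r" by blast
    have n: "- of_int \<lfloor>r\<rfloor> \<in> (\<int> :: real set)" by simp
    have "r + - of_int \<lfloor>r\<rfloor> \<in> allowed D j" "p = shadow D j (r + - of_int \<lfloor>r\<rfloor>)"
      unfolding allowed_shift[OF n] shadow_shift[OF n] using r by simp_all
    moreover have "r + - of_int \<lfloor>r\<rfloor> \<in> {0..1}" by simp linarith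
    ultimately show "p \<in> shadow D j ` (allowed D j \<inter> {0..1})" by blast
  qed auto
  ultimately show ?thesis by (simp add: compact_imp_closed)
qed

lemma arc_of_in_arcs: "r \<in> allowed D j \<Longrightarrow> arc_of j r \<in> arcs D"
  unfolding arcs_def arc_at_def picture_eq by (intro componentsI) (auto simp: strand_def)

lemma arcs_cases:
  assumes "a \<in> arcs D"
  obtains j r where "r \<in> allowed D j" and "a = arc_of j r"
  using assms unfolding arcs_def components_iff arc_at_def picture_eq strand_def by blast

lemma mem_arc_of: "r \<in> allowed D j \<Longrightarrow> shadow D j r \<in> arc_of j r"
  unfolding arc_at_def picture_eq by (auto simp: strand_def)

text \<open>The picture is a finite union of disjoint closed strands, so a connected subset cannot
  meet two of them.\<close>

lemma arc_of_subset_strand: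
  assumes "r \<in> allowed D j"
  shows "arc_of j r \<subseteq> strand D j"
proof -
  let ?B = "\<Union>k\<in>-{j}. strand D k"
  have sub: "arc_of j r \<subseteq> strand D j \<union> ?B"
    using connected_component_subset[of "picture D" "shadow D j r"] by (auto simp: picture_eq arc_at_def)
  have "strand D j \<inter> ?B \<inter> arc_of j r = {}"
    using strand_disjoint by (fastforce simp: strand_def)
  moreover have "closed ?B" by (intro closed_UN) (auto intro: closed_strand)
  moreover have "connected (arc_of j r)" by (simp add: arc_at_def)
  moreover have "strand D j \<inter> arc_of j r \<noteq> {}"
    using mem_arc_of[OF assms] assms by (auto simp: strand_def)
  ultimately have "?B \<inter> arc_of j r = {}"
    using sub closed_strand[of j] by (metis connected_closedD)
  with sub show ?thesis by blast
qed

lemma arc_of_segment: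
  assumes "{r..r'} \<subseteq> allowed D j" and "x \<in> {r..r'}" and "y \<in> {r..r'}"
  shows "arc_of j x = arc_of j y" and "shadow D j x \<in> arc_of j y"
proof -
  have "connected (shadow D j ` {r..r'})"
    by (intro connected_continuous_image continuous_on_subset[OF continuous_shadow]) auto
  moreover have "shadow D j ` {r..r'} \<subseteq> picture D"
    using assms(1) by (auto simp: picture_eq strand_def)
  ultimately have "shadow D j ` {r..r'} \<subseteq> arc_of j y"
    unfolding arc_at_def using assms(3) by (intro connected_component_maximal) auto
  then show "shadow D j x \<in> arc_of j y" using assms(2) by blast
  then show "arc_of j x = arc_of j y"
    unfolding arc_at_def by (rule connected_component_eq)
qed

text \<open>An arc is not a single point, because the overpass at a crossing is not interrupted; so it
  cannot consist of crossings only.\<close>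

lemma kappa_arc_of_unique:
  assumes r: "r \<in> allowed D j"
  shows "arc_of j r \<subseteq> range (shadow D k) \<longleftrightarrow> k = j"
proof
  assume "k = j"
  then show "arc_of j r \<subseteq> range (shadow D k)"
    using arc_of_subset_strand[OF r] by (auto simp: strand_def)
next
  assume sub: "arc_of j r \<subseteq> range (shadow D k)"
  show "k = j"
  proof (rule ccontr)
    assume "k \<noteq> j"
    have dp: "\<exists>s. double_point D j u k s" if "shadow D j u \<in> arc_of j r" for u
      using that sub \<open>k \<noteq> j\<close> by (auto simp: double_point_def)
    obtain s where s: "double_point D j r k s" using dp mem_arc_of[OF r] by blast
    have "\<not> over_under D k s j r" using r gap_pos by (fastforce simp: allowed_def)
    then have o: "over_under D j r k s" using double_point_cases[OF s] by blast
    \<comment> \<open>The bound \<open>gap D\<close> keeps the segment after the overpass inside the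
      arc; a length below \<open>1\<close> makes the shadow injective on it.\<close>
    define \<epsilon> where "\<epsilon> = min (gap D) (1 / 2)"
    have \<epsilon>: "0 < \<epsilon>" "\<epsilon> \<le> gap D" "\<epsilon> < 1" using gap_pos by (auto simp: \<epsilon>_def)
    have seg: "{r..r + \<epsilon>} \<subseteq> allowed D j"
      using over_near_allowed[OF o] \<epsilon> by (auto simp: abs_if)
    have "inj_on (shadow D j) {r..r + \<epsilon>}"
    proof (rule inj_onI)
      fix x y assume xy: "x \<in> {r..r + \<epsilon>}" "y \<in> {r..r + \<epsilon>}" "shadow D j x = shadow D j y"
      then have "x - y \<in> \<int>" using strand_disjoint[of x j y j] seg by blast
      then obtain n where n: "x - y = of_int n" by (auto elim: Ints_cases)
      have "\<bar>real_of_int n\<bar> < 1" unfolding n[symmetric] using xy \<epsilon> by auto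
      then have "n = 0" by linarith
      with n show "x = y" by simp
    qed
    moreover have "infinite {r..r + \<epsilon>}" using \<epsilon> by (simp add: infinite_Icc_iff)
    moreover have "shadow D j ` {r..r + \<epsilon>} \<subseteq> crossings D"
    proof clarify
      fix x assume "x \<in> {r..r + \<epsilon>}"
      then have "shadow D j x \<in> arc_of j r" using arc_of_segment(2)[OF seg, of x r] \<epsilon> by auto
      then show "shadow D j x \<in> crossings D" using dp unfolding crossings_def by blast
    qed
    moreover have "finite (crossings D)" using regular by (simp add: regular_projection_def)
    ultimately show False by (meson finite_imageD finite_subset)
  qed
qed

lemma kappa_arc_of:
  assumes "r \<in> allowed D j"
  shows "kappa D (arc_of j r) = j"
  unfolding kappa_def kappa_arc_of_unique[OF assms] by simp

lemma has_vector_derivative_shift: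
  assumes "(shadow D i has_vector_derivative v) (at s)" and "s - s' \<in> \<int>"
  shows "(shadow D i has_vector_derivative v) (at s')"
proof -
  have "((\<lambda>x. x + (s - s')) has_vector_derivative 1) (at s')"
    by (auto intro!: derivative_eq_intros)
  moreover have "(shadow D i has_vector_derivative v) (at (s' + (s - s')))" using assms(1) by simp
  ultimately have "(shadow D i \<circ> (\<lambda>x. x + (s - s')) has_vector_derivative 1 *\<^sub>R v) (at s')"
    by (rule vector_diff_chain_at)
  moreover have "shadow D i \<circ> (\<lambda>x. x + (s - s')) = shadow D i"
    using shadow_shift[OF assms(2)] by (simp add: fun_eq_iff)
  ultimately show ?thesis by simp
qed

text \<open>Crossing data are unique up to periods and derivatives are unique, so the definite
  descriptions of the two arcs have values. The two alternatives correspond to the sign of the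
  determinant.\<close>

lemma under_arcs:
  assumes o: "over_under D i s j t" and c: "c = shadow D i s"
  shows "right_arc D c = arc_of j (t - gap D) \<and> left_arc D c = arc_of j (t + gap D) \<or>
    right_arc D c = arc_of j (t + gap D) \<and> left_arc D c = arc_of j (t - gap D)"
proof -
  have dp: "double_point D i s j t" using o by (simp add: over_under_def)
  obtain v w where v: "(shadow D i has_vector_derivative v) (at s)"
    and w: "(shadow D j has_vector_derivative w) (at t)"
    using regular dp unfolding regular_projection_def by blast
  have shift: "shadow D j (t' + e) = shadow D j (t + e)" "shadow D j (t' - e) = shadow D j (t - e)"
    if "t - t' \<in> \<int>" for t' e
    using shadow_height_cong(1)[of "t + e" "t' + e" j] shadow_height_cong(1)[of "t - e" "t' - e" j] that
    by simp_all
  have iff: "under_ends D c p q \<longleftrightarrow>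
      (if det (vector [v, w] :: real^2^2) > 0
       then p = shadow D j (t - gap D) \<and> q = shadow D j (t + gap D)
       else p = shadow D j (t + gap D) \<and> q = shadow D j (t - gap D))" for p q
  proof
    assume "under_ends D c p q"
    then obtain i' s' j' t' v' w' where o': "over_under D i' s' j' t'" and c': "c = shadow D i' s'"
      and v': "(shadow D i' has_vector_derivative v') (at s')"
      and w': "(shadow D j' has_vector_derivative w') (at t')"
      and pq: "if det (vector [v', w'] :: real^2^2) > 0
         then p = shadow D j' (t' - gap D) \<and> q = shadow D j' (t' + gap D)
         else p = shadow D j' (t' + gap D) \<and> q = shadow D j' (t' - gap D)"
      unfolding under_ends_def by blast
    have u: "i' = i" "s - s' \<in> \<int>" "j' = j" "t - t' \<in> \<int>"
      using over_under_unique[OF o o'] c c' by simp_all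
    have "v' = v" using vector_derivative_unique_at[OF v'[unfolded u(1)] has_vector_derivative_shift[OF v u(2)]] .
    moreover have "w' = w"
      using vector_derivative_unique_at[OF w'[unfolded u(3)] has_vector_derivative_shift[OF w u(4)]] .
    ultimately show "if det (vector [v, w] :: real^2^2) > 0
       then p = shadow D j (t - gap D) \<and> q = shadow D j (t + gap D)
       else p = shadow D j (t + gap D) \<and> q = shadow D j (t - gap D)"
      using pq unfolding u(3) shift[OF u(4)] by simp
  next
    assume "if det (vector [v, w] :: real^2^2) > 0
       then p = shadow D j (t - gap D) \<and> q = shadow D j (t + gap D)
       else p = shadow D j (t + gap D) \<and> q = shadow D j (t - gap D)"
    with o c v w show "under_ends D c p q" unfolding under_ends_def by blast
  qed
  show ?thesis
  proof (cases "det (vector [v, w] :: real^2^2) > 0")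
    case True
    then show ?thesis unfolding right_arc_def left_arc_def iff by simp
  next
    case False
    then show ?thesis unfolding right_arc_def left_arc_def iff by simp
  qed
qed

lemma crossings_cases:
  assumes "c \<in> crossings D"
  obtains i s j t where "over_under D i s j t" and "c = shadow D i s"
proof -
  obtain i s j t where dp: "c = shadow D i s" "double_point D i s j t"
    using assms unfolding crossings_def by blast
  then have "c = shadow D j t" by (simp add: double_point_def)
  with dp double_point_cases[OF dp(2)] that show ?thesis by blast
qed

text \<open>Induction on the number of steps of length \<open>2 * gap D\<close>, the parameter length skipped at an
  underpass: the parameters before and after an underpass are treated separately.\<close>

lemma arcs_along_strand:
  assumes inv: "\<And>c. c \<in> crossings D \<Longrightarrow> P (right_arc D c) \<longleftrightarrow> P (left_arc D c)"
  shows "\<lbrakk>r \<in> allowed D j; r' \<in> allowed D j; r \<le> r'; r' - r \<le> real n * (2 * gap D)\<rbrakk> \<Longrightarrow>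
    finite (arc_of j ` (allowed D j \<inter> {r..r'})) \<and> (P (arc_of j r) \<longleftrightarrow> P (arc_of j r'))"
proof (induction n arbitrary: r r')
  case 0
  then have "r' = r" by simp
  then show ?case by (simp add: Int_insert_right)
next
  case (Suc n)
  show ?case
  proof (cases "\<exists>i s t. over_under D i s j t \<and> t \<in> {r..r'}")
    case False
    \<comment> \<open>An underpass outside the interval is at least as far from \<open>x\<close> as
      from the nearer endpoint, which is allowed.\<close>
    have seg: "{r..r'} \<subseteq> allowed D j"
    proof
      fix x assume x: "x \<in> {r..r'}"
      have "gap D \<le> \<bar>x - t\<bar>" if o: "over_under D i s j t" for i s t
      proof -
        have "t \<notin> {r..r'}" using False o by blast
        moreover have "gap D \<le> \<bar>r - t\<bar>" "gap D \<le> \<bar>r' - t\<bar>"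
          using Suc.prems(1,2) o unfolding allowed_def by blast+
        ultimately show ?thesis using x by auto
      qed
      then show "x \<in> allowed D j" unfolding allowed_def by blast
    qed
    have eq: "arc_of j x = arc_of j r'" if "x \<in> {r..r'}" for x
      using arc_of_segment(1)[OF seg that, of r'] Suc.prems(3) by simp
    then have "arc_of j ` (allowed D j \<inter> {r..r'}) \<subseteq> {arc_of j r'}" by blast
    then have "finite (arc_of j ` (allowed D j \<inter> {r..r'}))" by (rule finite_subset) simp
    then show ?thesis using eq[of r] Suc.prems(3) by simp
  next
    case True
    then obtain i s t where o: "over_under D i s j t" and t: "t \<in> {r..r'}" by blast
    have "gap D \<le> \<bar>r - t\<bar>" "gap D \<le> \<bar>r' - t\<bar>"
      using Suc.prems(1,2) o unfolding allowed_def by blast+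
    then have le: "r \<le> t - gap D" "t + gap D \<le> r'" using t by auto
    note ends = under_ends_allowed[OF o]
    \<comment> \<open>The removed segment around \<open>t\<close> takes \<open>2 * gap D\<close>
      away from the total, so each remaining piece is one step shorter.\<close>
    have len: "r' - r \<le> real n * (2 * gap D) + 2 * gap D"
      using Suc.prems(4) by (simp add: algebra_simps)
    have 1: "finite (arc_of j ` (allowed D j \<inter> {r..t - gap D})) \<and> (P (arc_of j r) \<longleftrightarrow> P (arc_of j (t - gap D)))"
      by (rule Suc.IH[OF Suc.prems(1) ends(1) le(1)]) (use le len in linarith)
    have 2: "finite (arc_of j ` (allowed D j \<inter> {t + gap D..r'})) \<and> (P (arc_of j (t + gap D)) \<longleftrightarrow> P (arc_of j r'))"
      by (rule Suc.IH[OF ends(2) Suc.prems(2) le(2)]) (use le len in linarith)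
    have "shadow D i s \<in> crossings D"
      using o unfolding crossings_def over_under_def by blast
    from inv[OF this] under_arcs[OF o HOL.refl]
    have 3: "P (arc_of j (t - gap D)) \<longleftrightarrow> P (arc_of j (t + gap D))" by auto
    have "allowed D j \<inter> {r..r'} \<subseteq> (allowed D j \<inter> {r..t - gap D}) \<union> (allowed D j \<inter> {t + gap D..r'})"
    proof
      fix x assume x: "x \<in> allowed D j \<inter> {r..r'}"
      then have "gap D \<le> \<bar>x - t\<bar>" using o unfolding allowed_def by blast
      then have "x \<le> t - gap D \<or> t + gap D \<le> x" by linarith
      with x show "x \<in> (allowed D j \<inter> {r..t - gap D}) \<union> (allowed D j \<inter> {t + gap D..r'})" by auto
    qed
    then have "arc_of j ` (allowed D j \<inter> {r..r'})
      \<subseteq> arc_of j ` (allowed D j \<inter> {r..t - gap D}) \<union> arc_of j ` (allowed D j \<inter> {t + gap D..r'})"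
      by blast
    then have "finite (arc_of j ` (allowed D j \<inter> {r..r'}))"
      by (rule finite_subset) (use 1 2 in simp)
    with 1 2 3 show ?thesis by blast
  qed
qed

lemma arcs_along_strand':
  assumes "\<And>c. c \<in> crossings D \<Longrightarrow> P (right_arc D c) \<longleftrightarrow> P (left_arc D c)"
    and "r \<in> allowed D j" and "r' \<in> allowed D j" and "r \<le> r'"
  shows "finite (arc_of j ` (allowed D j \<inter> {r..r'})) \<and> (P (arc_of j r) \<longleftrightarrow> P (arc_of j r'))"
proof -
  obtain n where "(r' - r) / (2 * gap D) \<le> real n" using real_arch_simple by blast
  then have "r' - r \<le> real n * (2 * gap D)" using gap_pos by (simp add: field_simps)
  with assms show ?thesis by (intro arcs_along_strand)
qed

lemma allowed_nonempty: "\<exists>r. r \<in> allowed D j"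
proof (cases "\<exists>i s t. over_under D i s j t")
  case True
  then show ?thesis using under_ends_allowed by blast
next
  case False
  then show ?thesis by (auto simp: allowed_def)
qed

text \<open>All arcs of a component are met within one period from an allowed parameter to its
  translate. The finiteness half of \<open>arcs_along_strand'\<close> then applies, with a trivial
  predicate.\<close>

lemma finite_arcs: "finite (arcs D)"
proof -
  have "finite (arc_of j ` allowed D j)" for j
  proof -
    obtain r where r: "r \<in> allowed D j" using allowed_nonempty by blast
    then have r1: "r + 1 \<in> allowed D j" by (simp add: allowed_shift)
    have "arc_of j ` allowed D j \<subseteq> arc_of j ` (allowed D j \<inter> {r..r + 1})"
    proof clarify
      fix x assume x: "x \<in> allowed D j"
      have n: "- of_int \<lfloor>x - r\<rfloor> \<in> (\<int> :: real set)" by simp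
      have "x + - of_int \<lfloor>x - r\<rfloor> \<in> allowed D j" unfolding allowed_shift[OF n] by (rule x)
      moreover have "x + - of_int \<lfloor>x - r\<rfloor> \<in> {r..r + 1}" by simp linarith
      ultimately have "arc_of j (x + - of_int \<lfloor>x - r\<rfloor>) \<in> arc_of j ` (allowed D j \<inter> {r..r + 1})"
        by blast
      then show "arc_of j x \<in> arc_of j ` (allowed D j \<inter> {r..r + 1})"
        unfolding shadow_shift[OF n] .
    qed
    then show ?thesis
      using arcs_along_strand'[of "\<lambda>_. True", OF _ r r1] finite_subset by auto
  qed
  then have "finite (\<Union>j. arc_of j ` allowed D j)" by simp
  moreover have "arcs D \<subseteq> (\<Union>j. arc_of j ` allowed D j)" by (auto elim!: arcs_cases)
  ultimately show ?thesis by (rule finite_subset[rotated])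
qed

lemma tame_diagram: "tame_diagram D"
proof
  show "finite (arcs D)" by (rule finite_arcs)
  show "finite (crossings D)" using regular by (simp add: regular_projection_def)
next
  fix c assume "c \<in> crossings D"
  then obtain i s j t where o: "over_under D i s j t" and c: "c = shadow D i s"
    by (rule crossings_cases)
  show "over_arc D c \<in> arcs D"
    using over_near_allowed[OF o, of s] gap_pos by (simp add: over_arc_def c arc_of_in_arcs)
  show "right_arc D c \<in> arcs D" "left_arc D c \<in> arcs D"
    "kappa D (left_arc D c) = kappa D (right_arc D c)"
    using under_arcs[OF o c] under_ends_allowed[OF o] by (auto simp: arc_of_in_arcs kappa_arc_of)
next
  fix a i assume "a \<in> arcs D"
  then show "a \<subseteq> range (shadow D i) \<longleftrightarrow> i = kappa D a"
    by (rule arcs_cases) (simp add: kappa_arc_of_unique kappa_arc_of)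
next
  fix j
  obtain r where "r \<in> allowed D j" using allowed_nonempty by blast
  then show "\<exists>a\<in>arcs D. kappa D a = j" using arc_of_in_arcs kappa_arc_of by blast
next
  fix P a b
  assume inv: "\<And>c. c \<in> crossings D \<Longrightarrow> P (right_arc D c) \<longleftrightarrow> P (left_arc D c)"
    and a: "a \<in> arcs D" and b: "b \<in> arcs D" and k: "kappa D a = kappa D b" and "P a"
  obtain j r where r: "r \<in> allowed D j" "a = arc_of j r" using a by (rule arcs_cases)
  obtain j' r' where r': "r' \<in> allowed D j'" "b = arc_of j' r'" using b by (rule arcs_cases)
  have "j' = j" using k r r' by (simp add: kappa_arc_of)
  then have r'j: "r' \<in> allowed D j" "b = arc_of j r'" using r' by simp_all
  have "P a \<longleftrightarrow> P b"
  proof (cases "r \<le> r'")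
    case True
    with arcs_along_strand'[of P, OF inv r(1) r'j(1)] show ?thesis unfolding r(2) r'j(2) by blast
  next
    case False
    then have "r' \<le> r" by simp
    with arcs_along_strand'[of P, OF inv r'j(1) r(1)] show ?thesis unfolding r(2) r'j(2) by blast
  qed
  with \<open>P a\<close> show "P b" by simp
qed

end

text \<open>The choice of indexing in condition 3 is a bijection of the index types, which forces
  equal numbers of components. The diagrams are arbitrary, so no invariance under a change of
  diagram is presupposed.\<close>

theorem theorem11:
  fixes L :: "'m::finite \<Rightarrow> real \<Rightarrow> real^4"
    and L' :: "'n::finite \<Rightarrow> real \<Rightarrow> real^4"
    and D :: "'m diagram" and D' :: "'n diagram"
  assumes "link L" and "link L'"
    and "diagram_of D L" and "diagram_of D' L'"
  shows "(fundamental_quandle D \<cong>\<^sub>Q fundamental_quandle D' \<longrightarrow>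
            fundamental_alexander_quandle D \<cong>\<^sub>Q fundamental_alexander_quandle D') \<and>
         (fundamental_alexander_quandle D \<cong>\<^sub>Q fundamental_alexander_quandle D' \<longrightarrow>
            (\<exists>\<sigma> :: 'm \<Rightarrow> 'n. bij \<sigma> \<and> module_sequences_equivalent D (reindex \<sigma> D'))) \<and>
         ((\<exists>\<sigma> :: 'm \<Rightarrow> 'n. bij \<sigma> \<and> module_sequences_equivalent D (reindex \<sigma> D')) \<longrightarrow>
            total_alexander_quandle D \<cong>\<^sub>Q total_alexander_quandle D')"
proof -
  have "tame_diagram D" "tame_diagram D'"
    using assms regular_diagram_of_link regular_diagram.tame_diagram by blast+
  note * = tame_diagram_implications[OF this]
  show ?thesis by (intro conjI impI) (erule *)+
qed

end
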